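(* For any fixed integer $d \ge 2$, the transience class of the Abelian sandpile model on the $d$-dimensional grid $\square_n^d$ with $n^d$ non-sink vertices satisfies $\mathrm{tcl}(\square_n^d) = O(n^{3d-2}\log^{d+2} n)$ and $\mathrm{tcl}(\square_n^d) = \Omega(n^{3d-2})$ as $n\to\infty$.
   Context: The graph $\square_n^d$ has vertex set $\{1,\dots,n\}^d\cup\{s\}$, where $s$ is a sink vertex. Two non-sink vertices are joined by an edge if they differ by exactly $1$ in exactly one coordinate. Boundary vertices are joined to $s$ by additional (possibly parallel) edges so that every non-sink vertex has degree exactly $2d$. Abelian sandpile model on a finite multigraph $G$ with sink $s$: a configuration assigns a nonnegative integer number of grains $\sigma(v)$ to each non-sink vertex $v$. A non-sink vertex $v$ with $\sigma(v)\ge\deg(v)$ may topple, sending one grain along each incident edge; grains sent to $s$ disappear. A configuration in which no vertex can topple is stable, and stabilization is order-independent. One step of the process adds one grain at a chosen non-sink vertex and then stabilizes. A stable configuration is recurrent if it can be revisited by this process. The transience class $\mathrm{tcl}(G)$ is the maximum number of grains that can be added, one at a time at adversarially chosen non-sink vertices and stabilizing after each addition, starting from the empty configuration, before the configuration necessarily becomes recurrent. *)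

theory Defs
  imports Complex_Main "HOL-Library.Landau_Symbols"
begin

section \<open>The Abelian sandpile model on a finite multigraph with a sink\<close>

text \<open>An undirected multigraph is given by its edge multiplicities: \<open>mult G u v\<close> is the
  number of parallel edges between \<open>u\<close> and \<open>v\<close>.\<close>

record 'v sink_graph =
  verts :: "'v set"
  sink :: 'v
  mult :: "'v \<Rightarrow> 'v \<Rightarrow> nat"

locale finite_sink_graph =
  fixes G :: "'v sink_graph"
  assumes finite_verts: "finite (verts G)"
    and sink_in_verts: "sink G \<in> verts G"
    and mult_sym: "mult G u v = mult G v u"
    and no_loops: "mult G v v = 0"

definition nonsink :: "'v sink_graph \<Rightarrow> 'v set" where
  "nonsink G = verts G - {sink G}"

definition deg :: "'v sink_graph \<Rightarrow> 'v \<Rightarrow> nat" where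
  "deg G v = (\<Sum>w\<in>verts G. mult G v w)"

text \<open>A configuration is a function on the non-sink vertices, extended by \<open>0\<close> elsewhere.\<close>

type_synonym 'v config = "'v \<Rightarrow> nat"

definition is_config :: "'v sink_graph \<Rightarrow> 'v config \<Rightarrow> bool" where
  "is_config G \<sigma> \<longleftrightarrow> (\<forall>v. v \<notin> nonsink G \<longrightarrow> \<sigma> v = 0)"

definition empty_config :: "'v config" where
  "empty_config = (\<lambda>_. 0)"

definition stable :: "'v sink_graph \<Rightarrow> 'v config \<Rightarrow> bool" where
  "stable G \<sigma> \<longleftrightarrow> (\<forall>v\<in>nonsink G. \<sigma> v < deg G v)"

text \<open>The subtraction is only used when \<open>deg G v \<le> \<sigma> v\<close>; grains sent to the sink are lost.\<close>

definition topple :: "'v sink_graph \<Rightarrow> 'v \<Rightarrow> 'v config \<Rightarrow> 'v config" where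
  "topple G v \<sigma> =
     (\<lambda>w. if w = v then \<sigma> v - deg G v
          else if w \<in> nonsink G then \<sigma> w + mult G v w
          else \<sigma> w)"

definition topples_to :: "'v sink_graph \<Rightarrow> 'v config \<Rightarrow> 'v config \<Rightarrow> bool" where
  "topples_to G \<sigma> \<tau> \<longleftrightarrow> (\<exists>v\<in>nonsink G. deg G v \<le> \<sigma> v \<and> \<tau> = topple G v \<sigma>)"

text \<open>Stabilization is a relation here, covering every legal order of topplings; that the
  outcome does not depend on the order is a theorem about it and not part of the definition.\<close>

definition stabilizes_to :: "'v sink_graph \<Rightarrow> 'v config \<Rightarrow> 'v config \<Rightarrow> bool" where
  "stabilizes_to G \<sigma> \<tau> \<longleftrightarrow> (topples_to G)\<^sup>*\<^sup>* \<sigma> \<tau> \<and> stable G \<tau>"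

definition add_grain :: "'v \<Rightarrow> 'v config \<Rightarrow> 'v config" where
  "add_grain v \<sigma> = \<sigma>(v := Suc (\<sigma> v))"

definition sandpile_step :: "'v sink_graph \<Rightarrow> 'v config \<Rightarrow> 'v config \<Rightarrow> bool" where
  "sandpile_step G \<sigma> \<tau> \<longleftrightarrow> (\<exists>v\<in>nonsink G. stabilizes_to G (add_grain v \<sigma>) \<tau>)"

text \<open>Revisiting means returning after at least one step of the process, hence the
  irreflexive transitive closure.\<close>

definition recurrent :: "'v sink_graph \<Rightarrow> 'v config \<Rightarrow> bool" where
  "recurrent G \<sigma> \<longleftrightarrow> is_config G \<sigma> \<and> stable G \<sigma> \<and> (sandpile_step G)\<^sup>+\<^sup>+ \<sigma> \<sigma>"

definition transient_lengths :: "'v sink_graph \<Rightarrow> nat set" where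
  "transient_lengths G =
     {k. \<exists>c :: nat \<Rightarrow> 'v config. c 0 = empty_config
          \<and> (\<forall>i<k. sandpile_step G (c i) (c (Suc i)))
          \<and> (\<forall>i\<le>k. \<not> recurrent G (c i))}"

text \<open>On \<open>nat\<close>, \<open>Sup\<close> is the maximum of a finite nonempty set and \<open>Sup {} = 0\<close>; the empty
  case occurs when the empty configuration is itself recurrent (e.g. one non-sink vertex).
  Finiteness is lemma \<open>finite_transient_lengths\<close> below.\<close>

definition tcl :: "'v sink_graph \<Rightarrow> nat" where
  "tcl G = Sup (transient_lengths G)"

lemma is_config_topples_to:
  assumes "(topples_to G)\<^sup>*\<^sup>* \<sigma> \<tau>" "is_config G \<sigma>"
  shows "is_config G \<tau>"
  using assms
  by (induction rule: rtranclp_induct) (auto simp: topples_to_def topple_def is_config_def)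

lemma sandpile_step_stable:
  assumes "sandpile_step G \<sigma> \<tau>" "is_config G \<sigma>"
  shows "is_config G \<tau>" "stable G \<tau>"
proof -
  obtain v where v: "v \<in> nonsink G" "stabilizes_to G (add_grain v \<sigma>) \<tau>"
    using assms(1) by (auto simp: sandpile_step_def)
  have "is_config G (add_grain v \<sigma>)"
    using assms(2) v(1) by (auto simp: is_config_def add_grain_def)
  with v(2) show "is_config G \<tau>" "stable G \<tau>"
    by (auto simp: stabilizes_to_def intro: is_config_topples_to)
qed

lemma finite_stable_configs:
  assumes "finite (verts G)"
  shows "finite {\<sigma>. is_config G \<sigma> \<and> stable G \<sigma>}"
proof (rule finite_subset)
  let ?N = "Suc (\<Sum>v\<in>nonsink G. deg G v)"
  have fin: "finite (nonsink G)"
    using assms by (simp add: nonsink_def)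
  show "finite {\<sigma>. \<forall>v. (v \<in> nonsink G \<longrightarrow> \<sigma> v \<in> {..<?N}) \<and> (v \<notin> nonsink G \<longrightarrow> \<sigma> v = (0::nat))}"
    by (rule finite_set_of_finite_funs) (use fin in auto)
  show "{\<sigma>. is_config G \<sigma> \<and> stable G \<sigma>} \<subseteq>
      {\<sigma>. \<forall>v. (v \<in> nonsink G \<longrightarrow> \<sigma> v \<in> {..<?N}) \<and> (v \<notin> nonsink G \<longrightarrow> \<sigma> v = (0::nat))}"
  proof safe
    fix \<sigma> v assume s: "is_config G \<sigma>" "stable G \<sigma>"
    show "v \<notin> nonsink G \<Longrightarrow> \<sigma> v = 0" using s by (auto simp: is_config_def)
    assume v: "v \<in> nonsink G"
    have "\<sigma> v < deg G v" using s v by (auto simp: stable_def)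
    also have "\<dots> \<le> (\<Sum>v\<in>nonsink G. deg G v)" using fin v by (intro member_le_sum) auto
    finally show "\<sigma> v < ?N" by simp
  qed
qed

lemma finite_transient_lengths:
  assumes "finite (verts G)"
  shows "finite (transient_lengths G)"
proof -
  let ?S = "{\<sigma>. is_config G \<sigma> \<and> stable G \<sigma>}"
  have "k \<le> card ?S" if k: "k \<in> transient_lengths G" for k
  proof -
    obtain c where c0: "c 0 = empty_config"
      and step: "\<And>i. i < k \<Longrightarrow> sandpile_step G (c i) (c (Suc i))"
      and trans: "\<And>i. i \<le> k \<Longrightarrow> \<not> recurrent G (c i)"
      using k by (auto simp: transient_lengths_def)
    have conf: "is_config G (c i)" if "i \<le> k" for i
      using that
    proof (induction i)
      case 0
      then show ?case by (simp add: c0 empty_config_def is_config_def)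
    next
      case (Suc i)
      then show ?case using step[of i] sandpile_step_stable(1)[of G "c i"] by auto
    qed
    have stab: "stable G (c i)" if "i \<in> {1..k}" for i
      using that step[of "i - 1"] conf[of "i - 1"] sandpile_step_stable(2)[of G "c (i - 1)"]
      by auto
    have chain: "(sandpile_step G)\<^sup>+\<^sup>+ (c i) (c (Suc (i + m)))" if "i + m < k" for i m
      using that
      by (induction m) (auto intro: step tranclp.intros)
    have "inj_on c {1..k}"
    proof (rule linorder_inj_onI)
      fix i j assume ij: "i < j" "i \<in> {1..k}" "j \<in> {1..k}"
      show "c i \<noteq> c j"
        using chain[of i "j - i - 1"] trans[of i] conf[of i] stab[of i] ij
        by (auto simp: recurrent_def)
    qed auto
    then have "card (c ` {1..k}) = k" by (simp add: card_image)
    moreover have "card (c ` {1..k}) \<le> card ?S"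
      using conf stab finite_stable_configs[OF assms] by (intro card_mono) auto
    ultimately show ?thesis by simp
  qed
  then show ?thesis by (meson finite_nat_set_iff_bounded_le)
qed


section \<open>The grid\<close>

text \<open>Points of \<open>{1..n}\<^sup>d\<close> are lists of length \<open>d\<close>.\<close>

definition grid_points :: "nat \<Rightarrow> nat \<Rightarrow> nat list set" where
  "grid_points d n = {x. length x = d \<and> set x \<subseteq> {1..n}}"

definition grid_adj :: "nat \<Rightarrow> nat list \<Rightarrow> nat list \<Rightarrow> bool" where
  "grid_adj d x y \<longleftrightarrow>
     (\<exists>i<d. (x ! i = Suc (y ! i) \<or> y ! i = Suc (x ! i)) \<and> (\<forall>j<d. j \<noteq> i \<longrightarrow> x ! j = y ! j))"

definition grid_nbrs :: "nat \<Rightarrow> nat \<Rightarrow> nat list \<Rightarrow> nat list set" where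
  "grid_nbrs d n x = {y \<in> grid_points d n. grid_adj d x y}"

text \<open>The sink is \<open>None\<close>. The number of edges from a point to the sink is what is missing to
  degree \<open>2 * d\<close>; the subtraction does not truncate, see \<open>card_grid_nbrs_le\<close> below.\<close>

fun grid_mult :: "nat \<Rightarrow> nat \<Rightarrow> nat list option \<Rightarrow> nat list option \<Rightarrow> nat" where
  "grid_mult d n (Some x) (Some y) = (if grid_adj d x y then 1 else 0)"
| "grid_mult d n (Some x) None = 2 * d - card (grid_nbrs d n x)"
| "grid_mult d n None (Some y) = 2 * d - card (grid_nbrs d n y)"
| "grid_mult d n None None = 0"

definition grid :: "nat \<Rightarrow> nat \<Rightarrow> nat list option sink_graph" where
  "grid d n = \<lparr> verts = insert None (Some ` grid_points d n), sink = None, mult = grid_mult d n \<rparr>"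

lemma finite_grid_points: "finite (grid_points d n)"
  unfolding grid_points_def using finite_lists_length_eq[of "{1..n}" d] by (simp add: conj_commute)

lemma card_grid_points: "card (grid_points d n) = n ^ d"
  unfolding grid_points_def using card_lists_length_eq[of "{1..n}" d] by (simp add: conj_commute)

lemma card_grid_nbrs_le:
  assumes "x \<in> grid_points d n"
  shows "card (grid_nbrs d n x) \<le> 2 * d"
proof -
  let ?f = "\<lambda>(i, b). x[i := if b then Suc (x ! i) else x ! i - 1]"
  have "grid_nbrs d n x \<subseteq> ?f ` ({..<d} \<times> UNIV)"
  proof
    fix y assume "y \<in> grid_nbrs d n x"
    then obtain i where i: "i < d" "x ! i = Suc (y ! i) \<or> y ! i = Suc (x ! i)"
        "\<And>j. j < d \<Longrightarrow> j \<noteq> i \<Longrightarrow> x ! j = y ! j" and len: "length y = d"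
      by (auto simp: grid_nbrs_def grid_adj_def grid_points_def)
    have "y = ?f (i, y ! i = Suc (x ! i))"
      using i len assms by (auto simp: grid_points_def list_eq_iff_nth_eq nth_list_update)
    then show "y \<in> ?f ` ({..<d} \<times> UNIV)" using i(1) by blast
  qed
  then have "card (grid_nbrs d n x) \<le> card (?f ` ({..<d} \<times> (UNIV :: bool set)))"
    by (intro card_mono) auto
  also have "\<dots> \<le> card ({..<d} \<times> (UNIV :: bool set))" by (intro card_image_le) auto
  finally show ?thesis by simp
qed

lemma deg_grid:
  assumes "x \<in> grid_points d n"
  shows "deg (grid d n) (Some x) = 2 * d"
proof -
  have "deg (grid d n) (Some x)
      = (2 * d - card (grid_nbrs d n x)) + (\<Sum>y\<in>grid_points d n. if grid_adj d x y then 1 else 0)"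
    by (simp add: deg_def grid_def finite_grid_points sum.reindex image_iff)
  also have "(\<Sum>y\<in>grid_points d n. if grid_adj d x y then 1 else 0) = card (grid_nbrs d n x)"
    by (simp add: grid_nbrs_def finite_grid_points sum.If_cases Int_def)
  finally show ?thesis using card_grid_nbrs_le[OF assms] by simp
qed

lemma grid_adj_sym: "grid_adj d x y \<longleftrightarrow> grid_adj d y x"
proof -
  have "grid_adj d y x" if xy: "grid_adj d x y" for x y
  proof -
    obtain i where "i < d" "x ! i = Suc (y ! i) \<or> y ! i = Suc (x ! i)"
        "\<forall>j<d. j \<noteq> i \<longrightarrow> x ! j = y ! j"
      using xy unfolding grid_adj_def by blast
    then have "i < d \<and> (y ! i = Suc (x ! i) \<or> x ! i = Suc (y ! i))
        \<and> (\<forall>j<d. j \<noteq> i \<longrightarrow> y ! j = x ! j)"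
      by auto
    then show ?thesis unfolding grid_adj_def by blast
  qed
  then show ?thesis by blast
qed

lemma finite_sink_graph_grid: "finite_sink_graph (grid d n)"
proof
  fix u v :: "nat list option"
  show "mult (grid d n) u v = mult (grid d n) v u"
    by (cases u; cases v) (auto simp: grid_def dest: grid_adj_sym[THEN iffD1])
  show "mult (grid d n) v v = 0"
    by (cases v) (simp_all add: grid_def grid_adj_def)
qed (auto simp: grid_def finite_grid_points)

end

theory Submission
  imports Defs "HOL-Analysis.Convex"
begin

text \<open>Toppling at \<open>x\<close> changes \<open>\<Sum>x. \<sigma> x * h x\<close> by minus the Laplacian of \<open>h\<close> at \<open>x\<close>. If every vertex
  has toppled, the burning argument shows that the configuration is recurrent, so a transient one
  has a vertex \<open>v\<close> that never toppled; for \<open>h\<close> subharmonic off \<open>v\<close>, the number of grains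
  added is then at most \<open>\<Sum>x. deg x * h x\<close> divided by \<open>min h\<close>. Taking for \<open>h\<close> the expected occupation
  times, up to time of order \<open>n\<^sup>2\<close>, of the lazy walk started at \<open>v\<close> and killed at the boundary, the
  sine expansion of the walk bounds the numerator above, and its lowest mode bounds \<open>min h\<close> below.

  Conversely, a superharmonic \<open>h\<close> can only lose weight under topplings. Take the harmonic measure
  of a boundary point next to the corner \<open>(1, \<dots>, 1)\<close>: it is of constant order at this corner and at
  its neighbour, and of order \<open>1 / n ^ (3 * d - 2)\<close> at the opposite corner. So about \<open>n ^ (3 * d - 2)\<close>
  grains dropped at the opposite corner leave the corner and its neighbour both empty, which is
  impossible for a recurrent configuration.\<close>

section \<open>Potentials on sandpiles\<close>

text \<open>The delicate point of the upper bound is uniformity in \<open>v\<close>. At a corner the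
  lowest mode \<open>u\<close> is only of order n^(-d), so estimates that ignore the position of
  \<open>v\<close> would lose powers of n. The remedy is to compare every mode with the lowest one:
  the mode with indices k_i is at most the product of the k_i times \<open>u\<close>. Numerator and
  minimum of \<open>h\<close> then carry the same factor u(v), which cancels. The numerator is at
  most of order u(v) n^d log^2 n, the minimum at least of order u(v) n^(2-2d), and the quotient has
  exponent 3d - 2. The factors k_i lost in the comparison are regained in the numerator because an
  oscillating mode has small total mass, and in the minimum because high modes have died out by time
  n^2. For the lower bound let e = d - 1. Normalising the modes gives n^(-e), their values next to
  the boundary give n^(-2e), and the decay in the remaining direction gives n^(-1); together
  n^(-(3d-2)).\<close>

definition laplacian :: "'v sink_graph \<Rightarrow> ('v \<Rightarrow> real) \<Rightarrow> 'v \<Rightarrow> real" where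
  "laplacian G h x = real (deg G x) * h x - (\<Sum>y\<in>nonsink G. real (mult G x y) * h y)"

definition weight :: "'v sink_graph \<Rightarrow> ('v \<Rightarrow> real) \<Rightarrow> 'v config \<Rightarrow> real" where
  "weight G h \<sigma> = (\<Sum>x\<in>nonsink G. real (\<sigma> x) * h x)"

text \<open>\<open>run G \<sigma> k S \<tau>\<close>: some interleaving of \<open>k\<close> additions and of legal topplings at exactly
  the vertices in \<open>S\<close> leads from \<open>\<sigma>\<close> to \<open>\<tau>\<close>.\<close>

inductive run :: "'v sink_graph \<Rightarrow> 'v config \<Rightarrow> nat \<Rightarrow> 'v set \<Rightarrow> 'v config \<Rightarrow> bool" for G \<sigma> where
  run_refl: "run G \<sigma> 0 {} \<sigma>"
| run_add: "run G \<sigma> k S \<tau> \<Longrightarrow> v \<in> nonsink G \<Longrightarrow> run G \<sigma> (Suc k) S (add_grain v \<tau>)"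
| run_topple: "run G \<sigma> k S \<tau> \<Longrightarrow> v \<in> nonsink G \<Longrightarrow> deg G v \<le> \<tau> v
    \<Longrightarrow> run G \<sigma> k (insert v S) (topple G v \<tau>)"

lemma run_topplings:
  assumes "(topples_to G)\<^sup>*\<^sup>* \<tau> \<rho>" "run G \<sigma> k S \<tau>"
  shows "\<exists>S'. run G \<sigma> k S' \<rho>"
  using assms by (induction rule: rtranclp_induct) (auto simp: topples_to_def dest: run_topple)

lemma run_sandpile_step:
  assumes "sandpile_step G \<tau> \<rho>" "run G \<sigma> k S \<tau>"
  shows "\<exists>S'. run G \<sigma> (Suc k) S' \<rho>"
proof -
  obtain v where "v \<in> nonsink G" "(topples_to G)\<^sup>*\<^sup>* (add_grain v \<tau>) \<rho>"
    using assms(1) by (auto simp: sandpile_step_def stabilizes_to_def)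
  then show ?thesis using run_topplings run_add[OF assms(2)] by metis
qed

lemma run_sandpile_steps:
  assumes "(sandpile_step G)\<^sup>+\<^sup>+ \<sigma> \<rho>"
  shows "\<exists>k S. k > 0 \<and> run G \<sigma> k S \<rho>"
  using assms
proof (induction rule: tranclp_induct)
  case (base \<rho>)
  then show ?case using run_sandpile_step[OF _ run_refl] by blast
next
  case (step \<tau> \<rho>)
  then show ?case using run_sandpile_step by blast
qed

lemma run_subset: "run G \<sigma> k S \<tau> \<Longrightarrow> S \<subseteq> nonsink G"
  by (induction rule: run.induct) auto

context finite_sink_graph
begin

lemma finite_nonsink: "finite (nonsink G)"
  using finite_verts by (simp add: nonsink_def)

lemma deg_eq: "deg G x = mult G x (sink G) + (\<Sum>y\<in>nonsink G. mult G x y)"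
  unfolding deg_def nonsink_def
  using finite_verts sink_in_verts by (simp add: sum.remove)

lemma weight_add_grain:
  assumes "v \<in> nonsink G"
  shows "weight G h (add_grain v \<sigma>) = weight G h \<sigma> + h v"
proof -
  have "weight G h (add_grain v \<sigma>)
      = (\<Sum>x\<in>nonsink G. real (\<sigma> x) * h x + (if x = v then h x else 0))"
    unfolding weight_def add_grain_def by (intro sum.cong) (auto simp: algebra_simps)
  also have "\<dots> = weight G h \<sigma> + h v"
    using finite_nonsink assms by (simp add: weight_def sum.distrib)
  finally show ?thesis .
qed

lemma weight_topple:
  assumes "v \<in> nonsink G" "deg G v \<le> \<sigma> v"
  shows "weight G h (topple G v \<sigma>) = weight G h \<sigma> - laplacian G h v"
proof -
  have "weight G h (topple G v \<sigma>) = (\<Sum>x\<in>nonsink G. real (\<sigma> x) * h x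
      + real (mult G v x) * h x - (if x = v then real (deg G v) * h x else 0))"
    unfolding weight_def topple_def using assms(2) no_loops[of v]
    by (intro sum.cong) (auto simp: algebra_simps of_nat_diff)
  also have "\<dots> = weight G h \<sigma> - laplacian G h v"
    using finite_nonsink assms(1) by (simp add: weight_def laplacian_def sum.distrib sum_subtractf)
  finally show ?thesis .
qed

text \<open>The one vertex where \<open>h\<close> may have positive Laplacian is \<open>v\<close>,
  and it never topples, so no toppling lowers the weight. This admits potentials with a pole at
  \<open>v\<close>.\<close>

lemma run_weight_ge:
  assumes "run G \<sigma> k S \<tau>" "v \<notin> S"
    and "\<And>x. x \<in> nonsink G \<Longrightarrow> m \<le> h x"
    and "\<And>x. x \<in> nonsink G \<Longrightarrow> x \<noteq> v \<Longrightarrow> laplacian G h x \<le> 0"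
  shows "weight G h \<sigma> + real k * m \<le> weight G h \<tau>"
  using assms(1,2)
proof (induction rule: run.induct)
  case run_refl
  then show ?case by simp
next
  case (run_add k S \<tau> w)
  then show ?case using assms(3)[of w] by (simp add: weight_add_grain algebra_simps)
next
  case (run_topple k S \<tau> w)
  then show ?case using assms(4)[of w] by (auto simp: weight_topple)
qed

lemma topplings_weight_le:
  assumes "(topples_to G)\<^sup>*\<^sup>* \<sigma> \<tau>" "\<And>x. x \<in> nonsink G \<Longrightarrow> 0 \<le> laplacian G h x"
  shows "weight G h \<tau> \<le> weight G h \<sigma>"
  using assms(1)
proof (induction rule: rtranclp_induct)
  case (step \<tau> \<rho>)
  then show ?case using assms(2) by (fastforce simp: topples_to_def weight_topple)
qed simp

text \<open>Of two adjacent toppled vertices, the one whose last toppling came earlier has received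
  a grain from the other.\<close>

lemma run_adjacent_not_both_empty:
  assumes "run G \<sigma> k S \<tau>" "v \<in> S" "w \<in> S" "v \<noteq> w" "mult G v w > 0"
  shows "\<tau> v > 0 \<or> \<tau> w > 0"
  using assms
proof (induction rule: run.induct)
  case (run_add k S \<tau> u)
  then show ?case by (auto simp: add_grain_def)
next
  case (run_topple k S \<tau> u)
  have S: "S \<subseteq> nonsink G" using run_topple run_subset by blast
  show ?case
  proof (cases "u = v \<or> u = w")
    case True
    then show ?thesis using run_topple S mult_sym[of v w] by (auto simp: topple_def)
  next
    case False
    then show ?thesis using run_topple S by (auto simp: topple_def)
  qed
qed auto

end

section \<open>Dhar's burning test\<close>

text \<open>The list stands for the order of last topplings, earliest first. After its last toppling
  a vertex keeps every grain sent by the vertices that topple later, so it holds at least the sum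
  over its tail.\<close>

fun burnable :: "'v sink_graph \<Rightarrow> 'v config \<Rightarrow> 'v list \<Rightarrow> bool" where
  "burnable G \<sigma> [] = True"
| "burnable G \<sigma> (v # vs) \<longleftrightarrow> (\<Sum>w\<in>set vs. mult G w v) \<le> \<sigma> v \<and> burnable G \<sigma> vs"

lemma burnable_mono:
  assumes "burnable G \<sigma> vs" "\<And>v. v \<in> set vs \<Longrightarrow> \<sigma> v \<le> \<tau> v"
  shows "burnable G \<tau> vs"
  using assms by (induction vs) (auto intro: order_trans)

text \<open>The new last vertex has an empty tail and hence no obligation; the obligation of each
  earlier vertex grows by exactly the grains it receives from \<open>u\<close>.\<close>

lemma burnable_snoc:
  assumes "burnable G \<sigma> vs" "\<And>v. v \<in> set vs \<Longrightarrow> \<sigma> v + mult G u v \<le> \<tau> v" "u \<notin> set vs"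
  shows "burnable G \<tau> (vs @ [u])"
  using assms
proof (induction vs)
  case (Cons v vs)
  have "(\<Sum>w\<in>set vs. mult G w v) + mult G u v \<le> \<tau> v"
    using Cons.prems by (fastforce intro: order_trans[rotated])
  then show ?case using Cons by simp
qed simp

lemma burnable_remove1:
  assumes "burnable G \<sigma> vs"
  shows "burnable G \<sigma> (remove1 u vs)"
  using assms
proof (induction vs)
  case (Cons v vs)
  have "(\<Sum>w\<in>set (remove1 u vs). mult G w v) \<le> (\<Sum>w\<in>set vs. mult G w v)"
    by (intro sum_mono2) (use set_remove1_subset in fastforce)+
  then show ?case using Cons by (auto intro: order_trans)
qed simp

section \<open>Confluence of topplings\<close>

lemma topples_to_add:
  assumes "topples_to G \<sigma> \<tau>"
  shows "topples_to G (\<lambda>x. \<sigma> x + a x) (\<lambda>x. \<tau> x + a x)"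
proof -
  obtain v where "v \<in> nonsink G" "deg G v \<le> \<sigma> v" "\<tau> = topple G v \<sigma>"
    using assms by (auto simp: topples_to_def)
  then show ?thesis
    unfolding topples_to_def by (intro bexI[of _ v]) (auto simp: topple_def fun_eq_iff)
qed

lemma topplings_add:
  assumes "(topples_to G)\<^sup>*\<^sup>* \<sigma> \<tau>"
  shows "(topples_to G)\<^sup>*\<^sup>* (\<lambda>x. \<sigma> x + a x) (\<lambda>x. \<tau> x + a x)"
  using assms
  by (induction rule: rtranclp_induct) (auto intro: topples_to_add rtranclp.rtrancl_into_rtrancl)

text \<open>Legality matters because subtraction on \<open>nat\<close> truncates: at
  \<open>v\<close> the two sides are \<open>\<sigma> v + mult G w v - deg G v\<close> and
  \<open>\<sigma> v - deg G v + mult G w v\<close>.\<close>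

lemma topple_commute:
  assumes "v \<in> nonsink G" "w \<in> nonsink G" "v \<noteq> w" "deg G v \<le> \<sigma> v" "deg G w \<le> \<sigma> w"
  shows "topple G v (topple G w \<sigma>) = topple G w (topple G v \<sigma>)"
proof
  fix x
  show "topple G v (topple G w \<sigma>) x = topple G w (topple G v \<sigma>) x"
    using assms by (cases "x = v"; cases "x = w") (simp_all add: topple_def)
qed

lemma topples_to_diamond:
  assumes "topples_to G \<sigma> \<tau>" "topples_to G \<sigma> \<rho>" "\<tau> \<noteq> \<rho>"
  shows "\<exists>\<omega>. topples_to G \<tau> \<omega> \<and> topples_to G \<rho> \<omega>"
proof -
  obtain v where v: "v \<in> nonsink G" "deg G v \<le> \<sigma> v" "\<tau> = topple G v \<sigma>"
    using assms(1) by (auto simp: topples_to_def)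
  obtain w where w: "w \<in> nonsink G" "deg G w \<le> \<sigma> w" "\<rho> = topple G w \<sigma>"
    using assms(2) by (auto simp: topples_to_def)
  have "v \<noteq> w" using assms(3) v w by auto
  have "topples_to G \<tau> (topple G w \<tau>)"
    using v w \<open>v \<noteq> w\<close> unfolding topples_to_def by (intro bexI[of _ w]) (auto simp: topple_def)
  moreover have "topples_to G \<rho> (topple G v \<rho>)"
    using v w \<open>v \<noteq> w\<close> unfolding topples_to_def by (intro bexI[of _ v]) (auto simp: topple_def)
  ultimately show ?thesis using topple_commute[OF v(1) w(1) \<open>v \<noteq> w\<close> v(2) w(2)] v(3) w(3) by auto
qed

lemma stable_no_toppling: "stable G \<sigma> \<Longrightarrow> \<not> topples_to G \<sigma> \<tau>"
  by (auto simp: stable_def topples_to_def)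

text \<open>The diamond property pushes the competing toppling along the given path. One of the
  topplings of the path must absorb it, since the stable end point admits none.\<close>

lemma topplings_strip:
  assumes "(topples_to G)\<^sup>*\<^sup>* \<sigma> \<tau>" "topples_to G \<sigma> \<rho>" "stable G \<tau>"
  shows "(topples_to G)\<^sup>*\<^sup>* \<rho> \<tau>"
  using assms
proof (induction arbitrary: \<rho> rule: converse_rtranclp_induct)
  case base
  then show ?case using stable_no_toppling by blast
next
  case (step \<sigma> \<sigma>')
  show ?case
  proof (cases "\<sigma>' = \<rho>")
    case True
    then show ?thesis using step by simp
  next
    case False
    then obtain \<omega> where "topples_to G \<sigma>' \<omega>" "topples_to G \<rho> \<omega>"
      using topples_to_diamond[OF step(1) step.prems(1)] by auto
    then show ?thesis using step by (meson converse_rtranclp_into_rtranclp)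
  qed
qed

lemma stabilization_unique:
  assumes "stabilizes_to G \<sigma> \<tau>" "stabilizes_to G \<sigma> \<rho>"
  shows "\<tau> = \<rho>"
proof -
  have "(topples_to G)\<^sup>*\<^sup>* \<sigma> \<rho>" using assms(2) by (simp add: stabilizes_to_def)
  then have "(topples_to G)\<^sup>*\<^sup>* \<rho> \<tau>"
    by (induction rule: rtranclp_induct)
      (use assms(1) in \<open>auto simp: stabilizes_to_def intro: topplings_strip\<close>)
  then show ?thesis
    using assms(2) stable_no_toppling by (metis converse_rtranclpE stabilizes_to_def)
qed

context finite_sink_graph
begin

text \<open>Toppling \<open>v\<close> moves it to the end of the list: its own tail becomes empty,
  and every vertex now before it has just received the grains due from it.\<close>

lemma run_burnable:
  assumes "run G \<sigma> k S \<tau>"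
  shows "\<exists>vs. distinct vs \<and> set vs = S \<and> burnable G \<tau> vs"
  using assms
proof (induction rule: run.induct)
  case run_refl
  then show ?case by (intro exI[of _ "[]"]) auto
next
  case (run_add k S \<tau> v)
  then obtain vs where "distinct vs" "set vs = S" "burnable G \<tau> vs" by blast
  then show ?case
    by (intro exI[of _ vs]) (auto simp: add_grain_def elim!: burnable_mono)
next
  case (run_topple k S \<tau> v)
  then obtain vs where vs: "distinct vs" "set vs = S" "burnable G \<tau> vs" by blast
  have S: "S \<subseteq> nonsink G" using run_topple run_subset by blast
  have "burnable G (topple G v \<tau>) (remove1 v vs @ [v])"
    using burnable_remove1[OF vs(3)] vs S by (rule_tac burnable_snoc) (auto simp: topple_def)
  then show ?case using vs by (intro exI[of _ "remove1 v vs @ [v]"]) auto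
qed

text \<open>\<open>A\<close> is the set of vertices already fired, and \<open>\<tau>\<close> is what
  \<open>\<sigma>\<close> plus one grain per sink edge becomes after each of them has fired once. A
  fired vertex lacks exactly the grains still to come from \<open>vs\<close>, so
  \<open>\<sigma>\<close> is restored once \<open>vs\<close> is exhausted.\<close>

lemma burn:
  assumes "burnable G \<sigma> vs" "distinct vs" "set vs \<inter> A = {}" "set vs \<union> A = nonsink G"
    and "\<And>x. x \<in> set vs \<Longrightarrow> \<tau> x = \<sigma> x + mult G x (sink G) + (\<Sum>w\<in>A. mult G w x)"
    and "\<And>x. x \<in> A \<Longrightarrow> \<tau> x + (\<Sum>w\<in>set vs. mult G w x) = \<sigma> x"
    and "\<And>x. x \<notin> nonsink G \<Longrightarrow> \<tau> x = \<sigma> x"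
  shows "(topples_to G)\<^sup>*\<^sup>* \<tau> \<sigma>"
  using assms
proof (induction vs arbitrary: A \<tau>)
  case Nil
  then have "\<tau> = \<sigma>" by fastforce
  then show ?case by simp
next
  case (Cons v vs)
  have fin: "finite A" "finite (set vs)" using Cons.prems(4) finite_nonsink
    by (auto intro: finite_subset)
  have v: "v \<in> nonsink G" "v \<notin> A" "v \<notin> set vs" using Cons.prems by auto
  have "nonsink G = insert v (set vs \<union> A)" using Cons.prems(4) by auto
  then have "(\<Sum>y\<in>nonsink G. mult G v y) = (\<Sum>y\<in>set vs. mult G v y) + (\<Sum>y\<in>A. mult G v y)"
    using v fin no_loops[of v] Cons.prems(3) by (auto simp: sum.union_disjoint)
  then have deg: "deg G v
      = mult G v (sink G) + (\<Sum>y\<in>set vs. mult G y v) + (\<Sum>y\<in>A. mult G y v)"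
    by (simp add: deg_eq mult_sym[of v])
  have tv: "\<tau> v = \<sigma> v + mult G v (sink G) + (\<Sum>w\<in>A. mult G w v)"
    using Cons.prems(5)[of v] by simp
  have le: "(\<Sum>w\<in>set vs. mult G w v) \<le> \<sigma> v" using Cons.prems(1) by simp
  have "(topples_to G)\<^sup>*\<^sup>* (topple G v \<tau>) \<sigma>"
  proof (rule Cons.IH[where A = "insert v A"])
    fix x assume x: "x \<in> set vs"
    then have "x \<noteq> v" "x \<in> nonsink G" using v Cons.prems(4) by auto
    then show "topple G v \<tau> x
        = \<sigma> x + mult G x (sink G) + (\<Sum>w\<in>insert v A. mult G w x)"
      using v(2) fin x Cons.prems(5)[of x] by (simp add: topple_def)
  next
    fix x assume x: "x \<in> insert v A"
    show "topple G v \<tau> x + (\<Sum>w\<in>set vs. mult G w x) = \<sigma> x"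
    proof (cases "x = v")
      case True
      then show ?thesis using tv deg le by (simp add: topple_def)
    next
      case False
      then have "x \<in> A" "x \<in> nonsink G" using x Cons.prems(4) by auto
      then show ?thesis using False Cons.prems(6)[of x] v(3) by (simp add: topple_def)
    qed
  qed (use Cons.prems v in \<open>auto simp: topple_def\<close>)
  \<comment> \<open>The degree of \<open>v\<close> splits into edges to the sink, to
    \<open>A\<close> and to \<open>vs\<close>. The first two groups have already delivered their
    grains and \<open>burnable\<close> covers the third, so firing \<open>v\<close> is
    legal.\<close>
  moreover have "topples_to G \<tau> (topple G v \<tau>)"
    unfolding topples_to_def using v(1) tv deg le by (intro bexI[of _ v] conjI refl) linarith+
  ultimately show ?case by (metis converse_rtranclp_into_rtranclp)
qed

end

section \<open>Termination, recurrence and the two criteria\<close>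

text \<open>A positive, strictly superharmonic function certifies that grains keep getting lost:
  each toppling lowers the weight by at least a fixed amount, so stabilization terminates. On the
  grid the lowest mode serves.\<close>

locale dissipative_sink_graph = finite_sink_graph +
  fixes u :: "'a \<Rightarrow> real"
  assumes potential_pos: "x \<in> nonsink G \<Longrightarrow> u x > 0"
    and potential_superharmonic: "x \<in> nonsink G \<Longrightarrow> laplacian G u x > 0"
begin

lemma stabilization_exists: "\<exists>\<tau>. stabilizes_to G \<sigma> \<tau>"
proof -
  \<comment> \<open>The \<open>1\<close> keeps the set nonempty when there is no non-sink
    vertex.\<close>
  define e where "e = Min (insert 1 (laplacian G u ` nonsink G))"
  have e: "e > 0" "\<And>x. x \<in> nonsink G \<Longrightarrow> e \<le> laplacian G u x"
    unfolding e_def using finite_nonsink potential_superharmonic by auto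
  have "weight G u \<sigma> \<ge> 0" for \<sigma>
    unfolding weight_def using potential_pos by (intro sum_nonneg) (simp add: less_imp_le)
  then have dec: "nat \<lfloor>weight G u \<tau> / e\<rfloor> < nat \<lfloor>weight G u \<sigma> / e\<rfloor>" if st: "topples_to G \<sigma> \<tau>" for \<sigma> \<tau>
  proof -
    obtain v where v: "v \<in> nonsink G" "deg G v \<le> \<sigma> v" "\<tau> = topple G v \<sigma>"
      using st by (auto simp: topples_to_def)
    have "weight G u \<tau> + e \<le> weight G u \<sigma>" using weight_topple[OF v(1), of \<sigma> u] e(2)[OF v(1)] v(2,3) by simp
    then have "(weight G u \<tau> + e) / e \<le> weight G u \<sigma> / e"
      using e(1) by (intro divide_right_mono) auto
    then have "weight G u \<tau> / e + 1 \<le> weight G u \<sigma> / e"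
      using e(1) by (simp add: add_divide_distrib)
    moreover have "0 \<le> weight G u \<tau> / e" using \<open>\<And>\<sigma>. 0 \<le> weight G u \<sigma>\<close> e(1) by simp
    ultimately show ?thesis by linarith
  qed
  show ?thesis
  proof (induction "nat \<lfloor>weight G u \<sigma> / e\<rfloor>" arbitrary: \<sigma> rule: less_induct)
    case less
    show ?case
    proof (cases "stable G \<sigma>")
      case True
      then show ?thesis by (auto simp: stabilizes_to_def)
    next
      case False
      then obtain \<tau> where \<tau>: "topples_to G \<sigma> \<tau>"
        by (auto simp: stable_def topples_to_def not_less)
      obtain \<rho> where "stabilizes_to G \<tau> \<rho>" using less[OF dec[OF \<tau>]] by blast
      with \<tau> have "stabilizes_to G \<sigma> \<rho>"
        unfolding stabilizes_to_def by (meson converse_rtranclp_into_rtranclp)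
      then show ?thesis by blast
    qed
  qed
qed

text \<open>Otherwise \<open>u\<close> would have total Laplacian \<open>0\<close>.\<close>

lemma sink_edge_exists:
  assumes "nonsink G \<noteq> {}"
  shows "\<exists>x\<in>nonsink G. mult G x (sink G) > 0"
proof (rule ccontr)
  assume "\<not> ?thesis"
  then have deg: "deg G x = (\<Sum>y\<in>nonsink G. mult G x y)" if "x \<in> nonsink G" for x
    using that by (simp add: deg_eq)
  have "(\<Sum>x\<in>nonsink G. \<Sum>y\<in>nonsink G. real (mult G x y) * u y)
      = (\<Sum>y\<in>nonsink G. \<Sum>x\<in>nonsink G. real (mult G y x) * u y)"
    by (subst sum.swap) (simp add: mult_sym)
  also have "\<dots> = (\<Sum>y\<in>nonsink G. real (deg G y) * u y)"
    by (intro sum.cong) (simp_all add: deg sum_distrib_right)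
  finally have "(\<Sum>x\<in>nonsink G. laplacian G u x) = 0"
    by (simp add: laplacian_def sum_subtractf)
  moreover have "(\<Sum>x\<in>nonsink G. laplacian G u x) > 0"
    using assms finite_nonsink potential_superharmonic by (intro sum_pos) auto
  ultimately show False by simp
qed

text \<open>Extra grains never invalidate a toppling, so the intermediate stabilizations can be
  replayed with all grains present from the start. The strict closure is recorded because
  \<open>recurrent\<close> asks for at least one step.\<close>

lemma sandpile_steps_add:
  assumes "stable G \<sigma>" "set vs \<subseteq> nonsink G"
  shows "\<exists>\<tau>. (sandpile_step G)\<^sup>*\<^sup>* \<sigma> \<tau> \<and> (vs \<noteq> [] \<longrightarrow> (sandpile_step G)\<^sup>+\<^sup>+ \<sigma> \<tau>)
    \<and> stabilizes_to G (\<lambda>x. \<sigma> x + count_list vs x) \<tau>"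
  using assms
proof (induction vs arbitrary: \<sigma>)
  case Nil
  then show ?case by (intro exI[of _ \<sigma>]) (auto simp: stabilizes_to_def)
next
  case (Cons v vs)
  obtain \<rho> where \<rho>: "stabilizes_to G (add_grain v \<sigma>) \<rho>" using stabilization_exists by blast
  obtain \<tau> where \<tau>: "(sandpile_step G)\<^sup>*\<^sup>* \<rho> \<tau>" "stabilizes_to G (\<lambda>x. \<rho> x + count_list vs x) \<tau>"
    using Cons \<rho> by (auto simp: stabilizes_to_def)
  have "sandpile_step G \<sigma> \<rho>" using \<rho> Cons.prems by (auto simp: sandpile_step_def)
  moreover have "(\<lambda>x. add_grain v \<sigma> x + count_list vs x) = (\<lambda>x. \<sigma> x + count_list (v # vs) x)"
    by (auto simp: add_grain_def fun_eq_iff)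
  moreover have "(topples_to G)\<^sup>*\<^sup>* (\<lambda>x. add_grain v \<sigma> x + count_list vs x) (\<lambda>x. \<rho> x + count_list vs x)"
    using \<rho> topplings_add by (auto simp: stabilizes_to_def)
  ultimately show ?case using \<tau>
    by (intro exI[of _ \<tau>])
      (auto simp: stabilizes_to_def intro: rtranclp_trans rtranclp_into_tranclp2 converse_rtranclp_into_rtranclp)
qed

text \<open>Each vertex receives one grain per edge to the sink, as if the sink had toppled. By
  \<open>burn\<close>, firing every vertex once restores \<open>\<sigma>\<close>; uniqueness of
  stabilization identifies this with the outcome of the process, and \<open>sink_edge_exists\<close>
  ensures that some grain is added.\<close>

lemma recurrent_if_burnable:
  assumes "is_config G \<sigma>" "stable G \<sigma>" "distinct vs" "set vs = nonsink G" "burnable G \<sigma> vs"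
    and "nonsink G \<noteq> {}"
  shows "recurrent G \<sigma>"
proof -
  define bs where "bs = concat (map (\<lambda>v. replicate (mult G v (sink G)) v) vs)"
  have rep: "count_list (replicate k v) x = (if v = x then k else 0)" for k and v x :: 'a
    by (induction k) auto
  have count: "count_list bs x = (if x \<in> nonsink G then mult G x (sink G) else 0)" for x
    using assms(3) unfolding bs_def assms(4)[symmetric] by (induction vs) (auto simp: rep)
  obtain x where x: "x \<in> nonsink G" "mult G x (sink G) > 0"
    using sink_edge_exists[OF assms(6)] by blast
  then have "bs \<noteq> []" using count[of x] by auto
  moreover have "set bs \<subseteq> nonsink G" by (auto simp: bs_def assms(4))
  ultimately obtain \<tau> where \<tau>: "(sandpile_step G)\<^sup>+\<^sup>+ \<sigma> \<tau>"
      "stabilizes_to G (\<lambda>x. \<sigma> x + count_list bs x) \<tau>"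
    using sandpile_steps_add[OF assms(2)] by blast
  have "(topples_to G)\<^sup>*\<^sup>* (\<lambda>x. \<sigma> x + count_list bs x) \<sigma>"
    by (rule burn[OF assms(5,3), of "{}"]) (auto simp: assms(4) count)
  then have "\<tau> = \<sigma>"
    using stabilization_unique[OF \<tau>(2)] assms(2) by (simp add: stabilizes_to_def)
  then show ?thesis using \<tau>(1) assms(1,2) by (simp add: recurrent_def)
qed

lemma transient_length_le:
  assumes "k \<in> transient_lengths G" "nonsink G \<noteq> {}"
    and pot: "\<And>v. v \<in> nonsink G \<Longrightarrow> \<exists>h m. m > 0 \<and> (\<forall>x\<in>nonsink G. m \<le> h x)
      \<and> (\<forall>x\<in>nonsink G. x \<noteq> v \<longrightarrow> laplacian G h x \<le> 0)
      \<and> (\<Sum>x\<in>nonsink G. real (deg G x) * h x) \<le> B * m"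
  shows "real k \<le> B"
proof -
  obtain c where c0: "c 0 = empty_config"
    and step: "\<And>i. i < k \<Longrightarrow> sandpile_step G (c i) (c (Suc i))"
    and trans: "\<And>i. i \<le> k \<Longrightarrow> \<not> recurrent G (c i)"
    using assms(1) by (auto simp: transient_lengths_def)
  have "\<exists>S. run G (c 0) i S (c i)" if "i \<le> k" for i
    using that
  proof (induction i)
    case (Suc i)
    then show ?case using run_sandpile_step[OF step[of i]] by auto
  qed (use run_refl in blast)
  then obtain S where S: "run G (c 0) k S (c k)" by blast
  have conf: "is_config G (c i)" if "i \<le> k" for i
    using that
  proof (induction i)
    case 0
    then show ?case by (simp add: c0 empty_config_def is_config_def)
  next
    case (Suc i)
    then show ?case using step[of i] sandpile_step_stable(1)[of G "c i"] by auto
  qed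
  show ?thesis
  proof (cases "k = 0")
    \<comment> \<open>No last step supplies stability here, but only \<open>0 \<le> B\<close> is at
      stake.\<close>
    case True
    obtain v where "v \<in> nonsink G" using assms(2) by blast
    then obtain h m where hm: "m > 0" "\<forall>x\<in>nonsink G. m \<le> h x"
        "(\<Sum>x\<in>nonsink G. real (deg G x) * h x) \<le> B * m"
      using pot by blast
    then have "0 \<le> (\<Sum>x\<in>nonsink G. real (deg G x) * h x)" by (intro sum_nonneg) auto
    then have "0 \<le> B * m" using hm(3) by linarith
    then show ?thesis using hm(1) True by (simp add: zero_le_mult_iff)
  next
    case False
    have stab: "stable G (c k)"
      using step[of "k - 1"] conf[of "k - 1"] sandpile_step_stable(2)[of G "c (k - 1)"] False by auto
    obtain vs where vs: "distinct vs" "set vs = S" "burnable G (c k) vs"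
      using run_burnable[OF S] by blast
    have "S \<noteq> nonsink G"
      using recurrent_if_burnable[OF conf stab vs(1) _ vs(3) assms(2)] trans[of k] vs(2) by blast
    then obtain v where v: "v \<in> nonsink G" "v \<notin> S" using run_subset[OF S] by blast
    obtain h m where hm: "m > 0" "\<forall>x\<in>nonsink G. m \<le> h x"
        "\<forall>x\<in>nonsink G. x \<noteq> v \<longrightarrow> laplacian G h x \<le> 0"
        "(\<Sum>x\<in>nonsink G. real (deg G x) * h x) \<le> B * m"
      using pot[OF v(1)] by blast
    have "real k * m \<le> weight G h (c k)"
      using run_weight_ge[OF S v(2), of m h] hm by (simp add: c0 empty_config_def weight_def)
    also have "\<dots> \<le> (\<Sum>x\<in>nonsink G. real (deg G x) * h x)"
      unfolding weight_def
    proof (intro sum_mono mult_right_mono)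
      fix x assume x: "x \<in> nonsink G"
      show "real (c k x) \<le> real (deg G x)" using stab x by (auto simp: stable_def less_imp_le)
      show "0 \<le> h x" using hm(1,2) x by force
    qed
    also have "\<dots> \<le> B * m" by (rule hm)
    finally show ?thesis using hm(1) by simp
  qed
qed

text \<open>A loop from \<open>\<sigma>\<close> to itself adds a positive number of grains. If some
  \<open>x\<close> never toppled, the weight for the potential of \<open>x\<close> would strictly
  increase around the loop; so every vertex topples, in particular \<open>v\<close> and
  \<open>w\<close>.\<close>

lemma recurrent_not_both_empty:
  assumes "recurrent G \<sigma>" "v \<in> nonsink G" "w \<in> nonsink G" "v \<noteq> w" "mult G v w > 0"
    and pot: "\<And>v. v \<in> nonsink G \<Longrightarrow> \<exists>h m. m > 0 \<and> (\<forall>x\<in>nonsink G. m \<le> h x)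
      \<and> (\<forall>x\<in>nonsink G. x \<noteq> v \<longrightarrow> laplacian G h x \<le> 0)"
  shows "\<sigma> v > 0 \<or> \<sigma> w > 0"
proof -
  have "(sandpile_step G)\<^sup>+\<^sup>+ \<sigma> \<sigma>" using assms(1) by (simp add: recurrent_def)
  then obtain k S where kS: "k > 0" "run G \<sigma> k S \<sigma>" using run_sandpile_steps[of G \<sigma> \<sigma>] by blast
  have "x \<in> S" if x: "x \<in> nonsink G" for x
  proof (rule ccontr)
    assume "x \<notin> S"
    obtain h m where hm: "m > 0" "\<forall>y\<in>nonsink G. m \<le> h y"
        "\<forall>y\<in>nonsink G. y \<noteq> x \<longrightarrow> laplacian G h y \<le> 0"
      using pot[OF x] by blast
    have "weight G h \<sigma> + real k * m \<le> weight G h \<sigma>"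
      using run_weight_ge[OF kS(2) \<open>x \<notin> S\<close>, of m h] hm by blast
    then show False using kS(1) hm(1) by (simp add: mult_le_0_iff)
  qed
  then show ?thesis using run_adjacent_not_both_empty[OF kS(2)] assms(2-5) by simp
qed

lemma transient_lengthI:
  assumes "y \<in> nonsink G" "v \<in> nonsink G" "w \<in> nonsink G" "v \<noteq> w" "mult G v w > 0"
    and pot: "\<And>v. v \<in> nonsink G \<Longrightarrow> \<exists>h m. m > 0 \<and> (\<forall>x\<in>nonsink G. m \<le> h x)
      \<and> (\<forall>x\<in>nonsink G. x \<noteq> v \<longrightarrow> laplacian G h x \<le> 0)"
    and h: "\<And>x. x \<in> nonsink G \<Longrightarrow> 0 \<le> h x" "\<And>x. x \<in> nonsink G \<Longrightarrow> 0 \<le> laplacian G h x"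
    and k: "real k * h y < h v" "real k * h y < h w"
  shows "k \<in> transient_lengths G"
proof -
  obtain f where f: "\<And>\<sigma>. stabilizes_to G (add_grain y \<sigma>) (f \<sigma>)"
  proof
    show "stabilizes_to G (add_grain y \<sigma>) (SOME \<tau>. stabilizes_to G (add_grain y \<sigma>) \<tau>)" for \<sigma>
      using stabilization_exists by (rule someI_ex)
  qed
  define c where "c i = (f ^^ i) empty_config" for i
  have step: "sandpile_step G (c i) (c (Suc i))" for i
    using f assms(1) by (auto simp: sandpile_step_def c_def)
  have wt: "weight G h (c i) \<le> real i * h y" for i
  proof (induction i)
    case 0
    then show ?case by (simp add: c_def empty_config_def weight_def)
  next
    case (Suc i)
    have "weight G h (c (Suc i)) \<le> weight G h (add_grain y (c i))"
      using f h(2) by (intro topplings_weight_le) (auto simp: c_def stabilizes_to_def)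
    then show ?case using Suc weight_add_grain[OF assms(1)] by (simp add: algebra_simps)
  qed
  have zero: "c i x = 0" if i: "i \<le> k" and x: "x \<in> nonsink G" "real k * h y < h x" for i x
  proof (rule ccontr)
    assume "c i x \<noteq> 0"
    then have "h x \<le> real (c i x) * h x" using h(1)[OF x(1)] by (simp add: mult_le_cancel_right1)
    also have "\<dots> \<le> weight G h (c i)"
      unfolding weight_def using x(1) finite_nonsink h(1) by (intro member_le_sum) auto
    also have "\<dots> \<le> real i * h y" by (rule wt)
    also have "\<dots> \<le> real k * h y" using i h(1)[OF assms(1)] by (intro mult_right_mono) auto
    finally show False using x(2) by simp
  qed
  have "\<not> recurrent G (c i)" if "i \<le> k" for i
    using recurrent_not_both_empty[OF _ assms(2-5) pot, of "c i"] zero[OF that assms(2) k(1)]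
      zero[OF that assms(3) k(2)] by auto
  then show ?thesis
    unfolding transient_lengths_def using step by (auto intro!: exI[of _ c] simp: c_def)
qed

end

section \<open>Dirichlet eigenfunctions of a path\<close>

declare of_nat_Suc [simp del]

lemma real_Suc_0 [simp]: "real (Suc 0) = 1"
  by (simp add: of_nat_Suc)

lemma abs_sin_of_nat_mult_le: "\<bar>sin (real k * x)\<bar> \<le> real k * \<bar>sin x\<bar>"
proof (induction k)
  case (Suc k)
  have "\<bar>sin (real (Suc k) * x)\<bar> \<le> \<bar>sin (real k * x)\<bar> * \<bar>cos x\<bar> + \<bar>cos (real k * x)\<bar> * \<bar>sin x\<bar>"
    using abs_triangle_ineq[of "sin (real k * x) * cos x" "cos (real k * x) * sin x"]
    by (simp only: of_nat_Suc distrib_right mult_1_left add.commute[of 1] sin_add abs_mult)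
  also have "\<dots> \<le> \<bar>sin (real k * x)\<bar> * 1 + 1 * \<bar>sin x\<bar>"
    by (intro add_mono mult_mono) auto
  finally show ?case using Suc by (simp add: distrib_right of_nat_Suc)
qed simp

text \<open>Jordan's inequality: a concave function lies above its chord.\<close>

lemma sin_ge_linear:
  assumes "0 \<le> x" "x \<le> pi / 2"
  shows "2 * x / pi \<le> sin x"
proof -
  have "convex_on {0..pi / 2} (\<lambda>x. - sin x)"
  proof (rule f''_ge0_imp_convex)
    show "((\<lambda>x. - sin x) has_real_derivative - cos x) (at x)" for x :: real
      by (auto intro!: derivative_eq_intros)
    show "((\<lambda>x. - cos x) has_real_derivative sin x) (at x)" for x :: real
      by (auto intro!: derivative_eq_intros)
    show "0 \<le> sin x" if "x \<in> {0..pi / 2}" for x :: real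
      using that pi_gt_zero by (intro sin_ge_zero) auto
  qed auto
  from convex_onD[OF this, of "2 * x / pi" 0 "pi / 2"] assms
  show ?thesis by (simp add: field_simps)
qed

text \<open>Multiplication by \<open>2 * sin (\<phi> / 2)\<close> makes the sum telescope, as for
  the conjugate Dirichlet kernel.\<close>

lemma abs_sum_sin_le:
  assumes "0 < \<phi>" "\<phi> < pi"
  shows "\<bar>\<Sum>j=1..n. sin (real j * \<phi>)\<bar> \<le> 1 / sin (\<phi> / 2)"
proof -
  have pos: "sin (\<phi> / 2) > 0" using assms by (intro sin_gt_zero) auto
  have "2 * sin (\<phi> / 2) * (\<Sum>j=1..n. sin (real j * \<phi>)) = cos (\<phi> / 2) - cos ((real n + 1 / 2) * \<phi>)"
  proof (induction n)
    case (Suc n)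
    have "2 * sin (\<phi> / 2) * sin (real (Suc n) * \<phi>)
        = cos ((real n + 1 / 2) * \<phi>) - cos ((real (Suc n) + 1 / 2) * \<phi>)"
    proof -
      have e: "(real n + 1 / 2) * \<phi> = real (Suc n) * \<phi> - \<phi> / 2"
        "(real (Suc n) + 1 / 2) * \<phi> = real (Suc n) * \<phi> + \<phi> / 2"
        by (simp_all add: algebra_simps of_nat_Suc)
      show ?thesis unfolding e cos_diff cos_add by simp
    qed
    then show ?case using Suc by (simp add: algebra_simps)
  qed simp
  moreover have "\<bar>cos (\<phi> / 2) - cos ((real n + 1 / 2) * \<phi>)\<bar> \<le> 2"
    using abs_cos_le_one[of "\<phi> / 2"] abs_cos_le_one[of "(real n + 1 / 2) * \<phi>"] by linarith
  ultimately have "2 * sin (\<phi> / 2) * \<bar>\<Sum>j=1..n. sin (real j * \<phi>)\<bar> \<le> 2"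
    using pos abs_mult[of "2 * sin (\<phi> / 2)" "\<Sum>j=1..n. sin (real j * \<phi>)"] by simp
  then show ?thesis using pos by (simp add: field_simps)
qed

text \<open>Telescoping again. With \<open>Suc n\<close> times the angle a multiple \<open>m\<close>
  of \<open>pi\<close>, the value depends only on the parity of \<open>m\<close>; orthogonality
  rests on this.\<close>

lemma sum_cos:
  assumes "sin (\<phi> / 2) \<noteq> 0" "real (Suc n) * \<phi> = pi * of_int m"
  shows "(\<Sum>k=1..n. cos (real k * \<phi>)) = - (1 + cos (pi * of_int m)) / 2"
proof -
  have "2 * sin (\<phi> / 2) * (\<Sum>k=1..n. cos (real k * \<phi>)) = sin ((real n + 1 / 2) * \<phi>) - sin (\<phi> / 2)"
  proof (induction n)
    case (Suc n)
    have "2 * sin (\<phi> / 2) * cos (real (Suc n) * \<phi>)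
        = sin ((real (Suc n) + 1 / 2) * \<phi>) - sin ((real n + 1 / 2) * \<phi>)"
    proof -
      have e: "(real n + 1 / 2) * \<phi> = real (Suc n) * \<phi> - \<phi> / 2"
        "(real (Suc n) + 1 / 2) * \<phi> = real (Suc n) * \<phi> + \<phi> / 2"
        by (simp_all add: algebra_simps of_nat_Suc)
      show ?thesis unfolding e sin_diff sin_add by simp
    qed
    then show ?case using Suc by (simp add: algebra_simps)
  qed simp
  also have "(real n + 1 / 2) * \<phi> = pi * of_int m - \<phi> / 2"
    using assms(2) by (simp add: algebra_simps of_nat_Suc)
  also have "sin (pi * of_int m - \<phi> / 2) = - cos (pi * of_int m) * sin (\<phi> / 2)"
    using sin_int_times_real[of m] by (simp add: sin_diff mult.commute)
  finally have "sin (\<phi> / 2) * (2 * (\<Sum>k=1..n. cos (real k * \<phi>)) + 1 + cos (pi * of_int m)) = 0"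
    by (simp add: algebra_simps)
  then have "2 * (\<Sum>k=1..n. cos (real k * \<phi>)) + 1 + cos (pi * of_int m) = 0"
    using assms(1) by (simp only: mult_eq_0_iff simp_thms)
  moreover have "s = - (1 + c) / 2" if "2 * s + 1 + c = 0" for s c :: real
    using that by simp
  ultimately show ?thesis by blast
qed

text \<open>The eigenfunctions of the path \<open>{1..n}\<close> with Dirichlet boundary are
  \<open>sine_mode n k\<close> for \<open>1 \<le> k \<le> n\<close>.\<close>

definition sine_mode :: "nat \<Rightarrow> nat \<Rightarrow> nat \<Rightarrow> real" where
  "sine_mode n k j = sin (pi * real k * real j / real (Suc n))"

lemma sine_mode_boundary [simp]: "sine_mode n k 0 = 0" "sine_mode n k (Suc n) = 0"
  by (simp_all add: sine_mode_def)

lemma sine_mode_pos: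
  assumes "1 \<le> j" "j \<le> n"
  shows "sine_mode n 1 j > 0"
proof -
  have "real j / real (Suc n) < 1" using assms by simp
  then have "pi * (real j / real (Suc n)) < pi * 1" by (intro mult_strict_left_mono) auto
  moreover have "0 < pi * (real j / real (Suc n))" using assms by simp
  ultimately show ?thesis
    unfolding sine_mode_def using sin_gt_zero[of "pi * (real j / real (Suc n))"] by simp
qed

text \<open>This replaces the trivial bound 1 wherever the distance of \<open>j\<close> from the
  boundary must not be lost.\<close>

lemma abs_sine_mode_le:
  assumes "1 \<le> j" "j \<le> n"
  shows "\<bar>sine_mode n k j\<bar> \<le> real k * sine_mode n 1 j"
  using abs_sin_of_nat_mult_le[of k "pi * real j / real (Suc n)"] sine_mode_pos[OF assms]
  by (simp add: sine_mode_def mult.assoc mult.left_commute)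

lemma sine_mode_ge:
  assumes "1 \<le> j" "j \<le> n"
  shows "2 / real (Suc n) \<le> sine_mode n 1 j"
proof (cases "2 * j \<le> Suc n")
  case True
  have "2 / real (Suc n) \<le> 2 * (pi * (real j / real (Suc n))) / pi"
    using assms by (simp add: field_simps)
  also have "\<dots> \<le> sin (pi * (real j / real (Suc n)))"
  proof (rule sin_ge_linear)
    have "real j / real (Suc n) \<le> 1 / 2" using True by (simp add: field_simps)
    then have "pi * (real j / real (Suc n)) \<le> pi * (1 / 2)" by (intro mult_left_mono) auto
    then show "pi * (real j / real (Suc n)) \<le> pi / 2" by simp
  qed simp
  finally show ?thesis by (simp add: sine_mode_def)
next
  case False
  define i where "i = Suc n - j"
  have i: "1 \<le> i" "2 * i \<le> Suc n" "real j = real (Suc n) - real i" using assms False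
    by (auto simp: i_def)
  have "2 / real (Suc n) \<le> 2 * (pi * (real i / real (Suc n))) / pi"
    using i by (simp add: field_simps)
  also have "\<dots> \<le> sin (pi * (real i / real (Suc n)))"
  proof (rule sin_ge_linear)
    have "real i / real (Suc n) \<le> 1 / 2" using i by (simp add: field_simps)
    then have "pi * (real i / real (Suc n)) \<le> pi * (1 / 2)" by (intro mult_left_mono) auto
    then show "pi * (real i / real (Suc n)) \<le> pi / 2" by simp
  qed simp
  also have "\<dots> = sin (pi - pi * (real i / real (Suc n)))" by simp
  also have "pi - pi * (real i / real (Suc n)) = pi * real j / real (Suc n)"
    by (simp add: i(3) field_simps)
  finally show ?thesis by (simp add: sine_mode_def)
qed

lemma sine_mode_last_le: "sine_mode n 1 1 \<le> pi / real (Suc n)" "n \<ge> 1 \<Longrightarrow> sine_mode n 1 n \<le> pi / real (Suc n)"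
proof -
  show "sine_mode n 1 1 \<le> pi / real (Suc n)"
    unfolding sine_mode_def using sin_x_le_x[of "pi / real (Suc n)"] by simp
  have "pi * real n / real (Suc n) = pi - pi / real (Suc n)" by (simp add: field_simps of_nat_Suc)
  then have "sine_mode n 1 n = sine_mode n 1 1" by (simp add: sine_mode_def)
  then show "sine_mode n 1 n \<le> pi / real (Suc n)"
    using \<open>sine_mode n 1 1 \<le> pi / real (Suc n)\<close> by simp
qed

lemma sine_mode_neighbours:
  "sine_mode n k (Suc j) + sine_mode n k (j - 1)
    = 2 * cos (pi * real k / real (Suc n)) * sine_mode n k j" if "j \<ge> 1"
proof -
  define a where "a = pi * real k / real (Suc n)"
  have e: "pi * real k * real (Suc j) / real (Suc n) = real j * a + a"
    "pi * real k * real (j - 1) / real (Suc n) = real j * a - a"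
    "pi * real k * real j / real (Suc n) = real j * a"
    using that by (simp_all add: a_def field_simps of_nat_diff of_nat_Suc[of j])
  show ?thesis unfolding sine_mode_def e a_def[symmetric] sin_add sin_diff by simp
qed

text \<open>The product becomes a difference of cosines with indices \<open>a - b\<close> and
  \<open>a + b\<close>. These have equal parity, so for \<open>a \<noteq> b\<close> the two sums
  cancel, while for \<open>a = b\<close> they are \<open>n\<close> and \<open>-1\<close>. Summing
  over the mode index gives completeness directly.\<close>

lemma sine_mode_orthogonal:
  assumes "a \<in> {1..n}" "b \<in> {1..n}"
  shows "(\<Sum>k=1..n. sine_mode n k a * sine_mode n k b) = (if a = b then real (Suc n) / 2 else 0)"
proof -
  define f where "f m = pi * of_int m / real (Suc n)" for m :: int
  have half: "sin (f m / 2) \<noteq> 0" if "m \<noteq> 0" "\<bar>m\<bar> < 2 * int (Suc n)" for m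
  proof -
    have pos: "sin (f m / 2) > 0" if m: "m > 0" "m < 2 * int (Suc n)" for m
    proof (rule sin_gt_zero)
      have "real_of_int m / (2 * real (Suc n)) < 1" using m by (simp add: field_simps)
      then have "pi * (real_of_int m / (2 * real (Suc n))) < pi * 1"
        by (intro mult_strict_left_mono) auto
      then show "f m / 2 < pi" by (simp add: f_def mult.commute)
      show "0 < f m / 2" using m by (simp add: f_def)
    qed
    have "f (- m) = - f m" by (simp add: f_def)
    then show ?thesis using pos[of m] pos[of "- m"] that by (cases "m > 0") auto
  qed
  have "(\<Sum>k=1..n. sine_mode n k a * sine_mode n k b)
      = (\<Sum>k=1..n. (cos (real k * f (int a - int b)) - cos (real k * f (int a + int b))) / 2)"
  proof (intro sum.cong refl)
    fix k
    have e: "real k * f (int a - int b) = pi * real k * real a / real (Suc n) - pi * real k * real b / real (Suc n)"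
      "real k * f (int a + int b) = pi * real k * real a / real (Suc n) + pi * real k * real b / real (Suc n)"
      by (simp_all add: f_def field_simps)
    show "sine_mode n k a * sine_mode n k b
        = (cos (real k * f (int a - int b)) - cos (real k * f (int a + int b))) / 2"
      unfolding e cos_diff cos_add sine_mode_def by simp
  qed
  also have "\<dots> = ((\<Sum>k=1..n. cos (real k * f (int a - int b)))
      - (\<Sum>k=1..n. cos (real k * f (int a + int b)))) / 2"
    by (simp add: sum_subtractf flip: sum_divide_distrib)
  finally have sum: "(\<Sum>k=1..n. sine_mode n k a * sine_mode n k b) = \<dots>" .
  have plus: "(\<Sum>k=1..n. cos (real k * f (int a + int b))) = - (1 + cos (pi * of_int (int a + int b))) / 2"
    by (rule sum_cos[OF half]) (use assms in \<open>auto simp: f_def of_nat_Suc[where 'a = int]\<close>)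
  show ?thesis
  proof (cases "a = b")
    case True
    have "cos (pi * of_int (int a + int a)) = 1"
      using cos_int_2pin[of "int a"] by (simp add: algebra_simps)
    then show ?thesis using sum plus True by (simp add: f_def)
  next
    case False
    have minus: "(\<Sum>k=1..n. cos (real k * f (int a - int b))) = - (1 + cos (pi * of_int (int a - int b))) / 2"
      by (rule sum_cos[OF half]) (use assms False in \<open>auto simp: f_def of_nat_Suc[where 'a = int]\<close>)
    have "cos (pi * of_int (int a + int b)) = cos (pi * of_int (int a - int b))"
      using sin_npi[of b] by (simp add: distrib_left right_diff_distrib cos_add cos_diff mult.commute)
    then show ?thesis using sum plus minus False by simp
  qed
qed

lemma sin_half_ge:
  assumes "0 \<le> r" "r \<le> N" "0 < N"
  shows "r / N \<le> sin (pi * r / (2 * N))"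
proof -
  have "r / N \<le> 1" using assms by simp
  then have "pi / 2 * (r / N) \<le> pi / 2 * 1" by (intro mult_left_mono) auto
  then have "2 * (pi / 2 * (r / N)) / pi \<le> sin (pi / 2 * (r / N))"
    using assms by (intro sin_ge_linear) auto
  then show ?thesis by (simp add: field_simps)
qed

lemma sin_sq_half_ge:
  assumes "k \<le> n"
  shows "(real k / real (Suc n))\<^sup>2 \<le> (sin (pi * real k / (2 * real (Suc n))))\<^sup>2"
  using assms by (intro power_mono sin_half_ge) auto

text \<open>From \<open>sin (A + B) * sin (A - B) = (sin A)\<^sup>2 - (sin B)\<^sup>2\<close> and
  the linear lower bound on each factor. The numerator vanishes at \<open>k = 1\<close>, as a
  comparison with the top eigenvalue requires.\<close>

lemma sin_sq_half_diff_ge: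
  assumes "1 \<le> k" "k \<le> n"
  shows "((real k)\<^sup>2 - 1) / (real (Suc n))\<^sup>2
    \<le> (sin (pi * real k / (2 * real (Suc n))))\<^sup>2 - (sin (pi / (2 * real (Suc n))))\<^sup>2"
proof -
  define x where "x = pi / (2 * real (Suc n))"
  have lin: "r / real (Suc n) \<le> sin (r * x)" if r: "0 \<le> r" "r \<le> real (Suc n)" for r
    using sin_half_ge[OF r] by (simp add: x_def mult.commute)
  have le: "real k + 1 \<le> real (Suc n)" using assms by (simp add: of_nat_Suc)
  have "((real k)\<^sup>2 - 1) / (real (Suc n))\<^sup>2
      = (real k + 1) / real (Suc n) * ((real k - 1) / real (Suc n))"
    by (simp add: power2_eq_square algebra_simps)
  also have "\<dots> \<le> sin ((real k + 1) * x) * sin ((real k - 1) * x)"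
  proof (rule mult_mono)
    show "(real k + 1) / real (Suc n) \<le> sin ((real k + 1) * x)" using le by (intro lin) auto
    moreover have "0 \<le> (real k + 1) / real (Suc n)" by simp
    ultimately show "0 \<le> sin ((real k + 1) * x)" by linarith
    show "(real k - 1) / real (Suc n) \<le> sin ((real k - 1) * x)" using le assms by (intro lin) auto
    show "0 \<le> (real k - 1) / real (Suc n)" using assms by simp
  qed
  also have "\<dots> = (sin (real k * x))\<^sup>2 * (cos x)\<^sup>2 - (cos (real k * x))\<^sup>2 * (sin x)\<^sup>2"
    by (simp add: distrib_right left_diff_distrib sin_add sin_diff power2_eq_square algebra_simps)
  also have "\<dots> = (sin (real k * x))\<^sup>2 - (sin x)\<^sup>2"
    unfolding cos_squared_eq by (simp add: algebra_simps)
  finally show ?thesis by (simp add: x_def mult.commute)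
qed

text \<open>The gain 1/k from oscillation offsets the factor \<open>k\<close> of
  \<open>abs_sine_mode_le\<close> when a mode is evaluated at the start of the walk and summed over
  its end.\<close>

lemma abs_sum_sine_mode_le:
  assumes "1 \<le> k" "k \<le> n"
  shows "\<bar>\<Sum>j=1..n. sine_mode n k j\<bar> \<le> real (Suc n) / real k"
proof -
  define \<phi> where "\<phi> = pi * (real k / real (Suc n))"
  have "pi * (real k / real (Suc n)) < pi * 1" using assms by (intro mult_strict_left_mono) auto
  then have \<phi>: "0 < \<phi>" "\<phi> < pi" using assms by (auto simp: \<phi>_def)
  have "\<bar>\<Sum>j=1..n. sine_mode n k j\<bar> = \<bar>\<Sum>j=1..n. sin (real j * \<phi>)\<bar>"
    by (simp add: sine_mode_def \<phi>_def mult_ac)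
  also have "\<dots> \<le> 1 / sin (\<phi> / 2)" by (rule abs_sum_sin_le[OF \<phi>])
  also have "\<dots> \<le> 1 / (2 * (\<phi> / 2) / pi)"
    using \<phi> by (intro divide_left_mono sin_ge_linear mult_pos_pos sin_gt_zero) auto
  also have "\<dots> = real (Suc n) / real k" by (simp add: \<phi>_def)
  finally show ?thesis .
qed

lemma sum_inverse_squares_le: "(\<Sum>j=1..n. 1 / (real j)\<^sup>2) \<le> 2"
proof (cases n)
  case (Suc m)
  have "(\<Sum>j=1..Suc m. 1 / (real j)\<^sup>2) \<le> 2 - 1 / real (Suc m)"
  proof (induction m)
    case (Suc m)
    have "1 / (real (Suc (Suc m)))\<^sup>2 \<le> 1 / real (Suc m) - 1 / real (Suc (Suc m))"
    proof -
      have "1 / (real (Suc (Suc m)))\<^sup>2 \<le> 1 / (real (Suc m) * real (Suc (Suc m)))"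
        unfolding power2_eq_square by (intro divide_left_mono mult_right_mono mult_pos_pos) auto
      also have "\<dots> = 1 / real (Suc m) - 1 / real (Suc (Suc m))"
        by (simp add: field_simps of_nat_Suc)
      finally show ?thesis .
    qed
    then show ?case using Suc by simp
  qed simp
  also have "\<dots> \<le> 2" by simp
  finally show ?thesis using Suc by simp
qed simp

section \<open>Dirichlet eigenfunctions of the grid\<close>

lemma grid_points_nth: "x \<in> grid_points d n \<Longrightarrow> i < d \<Longrightarrow> x ! i \<in> {1..n}"
  using nth_mem[of i x] by (force simp: grid_points_def)

lemma grid_points_iff_nth: "x \<in> grid_points d n \<longleftrightarrow> length x = d \<and> (\<forall>i<d. x ! i \<in> {1..n})"
  unfolding grid_points_def by (auto simp: subset_iff in_set_conv_nth)

lemma grid_points_Suc: "grid_points (Suc d) n = (\<lambda>(j, x). j # x) ` ({1..n} \<times> grid_points d n)"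
  by (auto simp: grid_points_def length_Suc_conv image_iff)

lemma sum_grid_points_Suc:
  "(\<Sum>x\<in>grid_points (Suc d) n. f x) = (\<Sum>j=1..n. \<Sum>x\<in>grid_points d n. f (j # x))"
proof -
  have "inj_on (\<lambda>(j, x). j # x) ({1..n} \<times> grid_points d n)" by (auto simp: inj_on_def)
  then show ?thesis
    by (simp add: grid_points_Suc sum.reindex sum.cartesian_product case_prod_unfold comp_def)
qed

text \<open>Distributivity over the box: spectral sums, once bounded by products over coordinates,
  reduce to one-dimensional sums.\<close>

lemma sum_grid_points_prod:
  fixes f :: "nat \<Rightarrow> nat \<Rightarrow> 'a :: comm_semiring_1"
  shows "(\<Sum>x\<in>grid_points d n. \<Prod>i<d. f i (x ! i)) = (\<Prod>i<d. \<Sum>j=1..n. f i j)"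
proof (induction d arbitrary: f)
  case 0
  have "grid_points 0 n = {[]}" by (auto simp: grid_points_def)
  then show ?case by (simp add: of_nat_Suc)
next
  case (Suc d)
  have "(\<Sum>x\<in>grid_points (Suc d) n. \<Prod>i<Suc d. f i (x ! i))
      = (\<Sum>j=1..n. \<Sum>x\<in>grid_points d n. f 0 j * (\<Prod>i<d. f (Suc i) (x ! i)))"
    by (simp add: sum_grid_points_Suc prod.lessThan_Suc_shift del: prod.lessThan_Suc)
  also have "\<dots> = (\<Sum>j=1..n. f 0 j) * (\<Prod>i<d. \<Sum>j=1..n. f (Suc i) j)"
    by (simp add: Suc.IH[of "\<lambda>i. f (Suc i)"] flip: sum_distrib_left sum_distrib_right)
  finally show ?case by (simp add: prod.lessThan_Suc_shift del: prod.lessThan_Suc)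
qed

lemma sum_grid_nbrs:
  assumes "x \<in> grid_points d n"
  shows "(\<Sum>y\<in>grid_nbrs d n x. f y)
    = (\<Sum>i<d. (if x ! i < n then f (x[i := Suc (x ! i)]) else 0)
            + (if 1 < x ! i then f (x[i := x ! i - 1]) else (0 :: real)))"
proof -
  \<comment> \<open>\<open>True\<close> is a step up and \<open>False\<close> a step down;
    \<open>P\<close> says that the step stays in the box. Coordinate and direction can be read off
    the result, whence injectivity.\<close>
  define g where "g = (\<lambda>(i, b). x[i := if b then Suc (x ! i) else x ! i - 1])"
  define P where "P = (\<lambda>(i, b). if b then x ! i < n else 1 < x ! i)"
  define S where "S = {p \<in> {..<d} \<times> (UNIV :: bool set). P p}"
  have len: "length x = d" using assms by (simp add: grid_points_def)
  have x: "1 \<le> x ! i" "x ! i \<le> n" if "i < d" for i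
    using grid_points_nth[OF assms that] by auto
  have "inj_on g S"
  proof (rule inj_onI)
    fix p q assume pq: "p \<in> S" "q \<in> S" "g p = g q"
    obtain i b where p: "p = (i, b)" by (cases p)
    obtain j c where q: "q = (j, c)" by (cases q)
    have ij: "i < d" "j < d" using pq p q by (auto simp: S_def)
    have ne: "g p ! i \<noteq> x ! i" "g q ! j \<noteq> x ! j"
      using ij len x[of i] x[of j] by (auto simp: g_def p q)
    have "i = j"
    proof (rule ccontr)
      assume "i \<noteq> j"
      then have "g q ! i = x ! i" using ij len by (simp add: g_def q)
      then show False using ne(1) pq(3) by simp
    qed
    moreover have "b = c"
      using arg_cong[OF pq(3), of "\<lambda>l. l ! i"] calculation ij len x[of i]
      by (auto simp: g_def p q split: if_splits)
    ultimately show "p = q" by (simp add: p q)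
  qed
  moreover have "g ` S = grid_nbrs d n x"
  proof
    show "g ` S \<subseteq> grid_nbrs d n x"
    proof
      fix y assume "y \<in> g ` S"
      then obtain i b where ib: "i < d" "P (i, b)" "y = g (i, b)" by (auto simp: S_def)
      have "y \<in> grid_points d n"
        unfolding grid_points_iff_nth
      proof (intro conjI allI impI)
        show "length y = d" using ib len by (simp add: g_def)
        fix j assume "j < d"
        then show "y ! j \<in> {1..n}" using ib x[of j] x[of i] len
          by (cases "i = j") (auto simp: g_def P_def split: if_splits)
      qed
      moreover have "grid_adj d x y"
        unfolding grid_adj_def using ib len x[of i]
        by (intro exI[of _ i]) (auto simp: g_def)
      ultimately show "y \<in> grid_nbrs d n x" by (simp add: grid_nbrs_def)
    qed
  next
    show "grid_nbrs d n x \<subseteq> g ` S"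
    proof
      fix y assume y: "y \<in> grid_nbrs d n x"
      then obtain i where i: "i < d" "x ! i = Suc (y ! i) \<or> y ! i = Suc (x ! i)"
          "\<And>j. j < d \<Longrightarrow> j \<noteq> i \<Longrightarrow> x ! j = y ! j"
        by (auto simp: grid_nbrs_def grid_adj_def)
      have yg: "y \<in> grid_points d n" using y by (simp add: grid_nbrs_def)
      then have ly: "length y = d" by (simp add: grid_points_def)
      have "y = g (i, y ! i = Suc (x ! i))"
        using i ly len by (auto simp: g_def list_eq_iff_nth_eq nth_list_update)
      moreover have "P (i, y ! i = Suc (x ! i))"
        using i grid_points_nth[OF yg i(1)] by (auto simp: P_def)
      ultimately show "y \<in> g ` S" using i(1) by (auto simp: S_def)
    qed
  qed
  ultimately have "(\<Sum>y\<in>grid_nbrs d n x. f y) = (\<Sum>p\<in>S. f (g p))"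
    by (metis (no_types, lifting) sum.reindex_cong)
  also have "\<dots> = (\<Sum>p\<in>{..<d} \<times> UNIV. if P p then f (g p) else 0)"
    unfolding S_def by (simp add: sum.inter_filter)
  also have "\<dots> = (\<Sum>i<d. \<Sum>b\<in>UNIV. if P (i, b) then f (g (i, b)) else 0)"
    by (simp add: sum.cartesian_product)
  moreover have "g (i, True) = x[i := Suc (x ! i)]" "g (i, False) = x[i := x ! i - 1]" for i
    by (simp_all add: g_def)
  ultimately show ?thesis by (simp add: UNIV_bool P_def add.commute del: One_nat_def cong: if_cong)
qed

text \<open>Separation of variables. The factors vanish at the face \<open>Suc n\<close> but are
  free at the face 0; the subtracted sum is what the missing neighbours there would contribute. It
  vanishes for sine modes and becomes the source of the corner measure.\<close>

lemma sum_grid_nbrs_prod: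
  fixes \<phi> :: "nat \<Rightarrow> nat \<Rightarrow> real"
  assumes x: "x \<in> grid_points d n"
    and bdry: "\<And>i. i < d \<Longrightarrow> \<phi> i (Suc n) = 0"
    and eigen: "\<And>i j. i < d \<Longrightarrow> 1 \<le> j \<Longrightarrow> j \<le> n \<Longrightarrow> \<phi> i (Suc j) + \<phi> i (j - 1) = c i * \<phi> i j"
  shows "(\<Sum>y\<in>grid_nbrs d n x. \<Prod>i<d. \<phi> i (y ! i))
    = (\<Sum>i<d. c i) * (\<Prod>i<d. \<phi> i (x ! i))
      - (\<Sum>i<d. if x ! i = 1 then \<phi> i 0 * (\<Prod>i'\<in>{..<d} - {i}. \<phi> i' (x ! i')) else 0)"
proof -
  have len: "length x = d" using x by (simp add: grid_points_def)
  have upd: "(\<Prod>i'<d. \<phi> i' (x[i := a] ! i')) = \<phi> i a * (\<Prod>i'\<in>{..<d} - {i}. \<phi> i' (x ! i'))"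
    if "i < d" for i a
    using that len by (subst prod.remove[of _ i]) auto
  have "(if x ! i < n then \<Prod>i'<d. \<phi> i' (x[i := Suc (x ! i)] ! i') else 0)
      + (if 1 < x ! i then \<Prod>i'<d. \<phi> i' (x[i := x ! i - 1] ! i') else 0)
      = c i * (\<Prod>i<d. \<phi> i (x ! i))
        - (if x ! i = 1 then \<phi> i 0 * (\<Prod>i'\<in>{..<d} - {i}. \<phi> i' (x ! i')) else 0)"
    if i: "i < d" for i
  proof -
    define R where "R = (\<Prod>i'\<in>{..<d} - {i}. \<phi> i' (x ! i'))"
    have xi: "1 \<le> x ! i" "x ! i \<le> n" using grid_points_nth[OF x i] by auto
    have F: "(\<Prod>i<d. \<phi> i (x ! i)) = \<phi> i (x ! i) * R"
      unfolding R_def using i by (subst prod.remove[of _ i]) auto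
    have "(if x ! i < n then \<phi> i (Suc (x ! i)) * R else 0) = \<phi> i (Suc (x ! i)) * R"
      using xi bdry[OF i] by (cases "x ! i = n") auto
    moreover have "(if 1 < x ! i then \<phi> i (x ! i - 1) * R else 0)
        = \<phi> i (x ! i - 1) * R - (if x ! i = 1 then \<phi> i 0 * R else 0)"
      using xi by auto
    moreover have "\<phi> i (Suc (x ! i)) * R + \<phi> i (x ! i - 1) * R = c i * (\<phi> i (x ! i) * R)"
      using eigen[OF i xi] by (metis distrib_right mult.assoc)
    ultimately show ?thesis unfolding upd[OF i] F R_def[symmetric] by linarith
  qed
  then show ?thesis
    unfolding sum_grid_nbrs[OF x] sum_distrib_right sum_subtractf[symmetric]
    by (intro sum.cong) simp_all
qed

lemma nonsink_grid: "nonsink (grid d n) = Some ` grid_points d n"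
  by (auto simp: nonsink_def grid_def)

lemma laplacian_grid:
  assumes "x \<in> grid_points d n"
  shows "laplacian (grid d n) h (Some x)
    = 2 * real d * h (Some x) - (\<Sum>y\<in>grid_nbrs d n x. h (Some y))"
proof -
  have "(\<Sum>y\<in>nonsink (grid d n). real (mult (grid d n) (Some x) y) * h y)
      = (\<Sum>y\<in>grid_points d n. if grid_adj d x y then h (Some y) else 0)"
    unfolding nonsink_grid by (auto simp: sum.reindex grid_def intro!: sum.cong)
  also have "\<dots> = (\<Sum>y\<in>grid_nbrs d n x. h (Some y))"
    unfolding grid_nbrs_def by (simp add: sum.inter_filter finite_grid_points)
  finally show ?thesis by (simp add: laplacian_def deg_grid[OF assms])
qed

definition grid_mode :: "nat \<Rightarrow> nat \<Rightarrow> nat list \<Rightarrow> nat list \<Rightarrow> real" where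
  "grid_mode d n k x = (\<Prod>i<d. sine_mode n (k ! i) (x ! i))"

text \<open>A quarter of the Laplacian eigenvalue of \<open>grid_mode d n k\<close>.\<close>

definition grid_freq :: "nat \<Rightarrow> nat \<Rightarrow> nat list \<Rightarrow> real" where
  "grid_freq d n k = (\<Sum>i<d. (sin (pi * real (k ! i) / (2 * real (Suc n))))\<^sup>2)"

lemma two_cos_sine_freq:
  "2 * cos (pi * real k / real (Suc n)) = 2 - 4 * (sin (pi * real k / (2 * real (Suc n))))\<^sup>2"
proof -
  have e: "pi * real k / real (Suc n) = 2 * (pi * real k / (2 * real (Suc n)))" by simp
  show ?thesis by (subst e, subst cos_double_sin) simp
qed

lemma sum_nbrs_grid_mode:
  assumes "x \<in> grid_points d n"
  shows "(\<Sum>y\<in>grid_nbrs d n x. grid_mode d n k y)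
    = (2 * real d - 4 * grid_freq d n k) * grid_mode d n k x"
proof -
  have "(\<Sum>y\<in>grid_nbrs d n x. grid_mode d n k y)
      = (\<Sum>i<d. 2 * cos (pi * real (k ! i) / real (Suc n))) * grid_mode d n k x"
    unfolding grid_mode_def
    by (subst sum_grid_nbrs_prod[OF assms, where c = "\<lambda>i. 2 * cos (pi * real (k ! i) / real (Suc n))"]) (use sine_mode_neighbours in \<open>simp_all cong: if_cong\<close>)
  also have "(\<Sum>i<d. 2 * cos (pi * real (k ! i) / real (Suc n))) = 2 * real d - 4 * grid_freq d n k"
    unfolding two_cos_sine_freq grid_freq_def by (simp add: sum_subtractf sum_distrib_left)
  finally show ?thesis .
qed

text \<open>The expansion of a point mass, used both for the initial state of the walk and for the
  boundary data of the corner measure.\<close>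

lemma grid_mode_complete:
  assumes "v \<in> grid_points d n" "x \<in> grid_points d n"
  shows "(2 / real (Suc n)) ^ d * (\<Sum>k\<in>grid_points d n. grid_mode d n k v * grid_mode d n k x)
    = (if x = v then 1 else 0)"
proof -
  have "(\<Sum>k\<in>grid_points d n. grid_mode d n k v * grid_mode d n k x)
      = (\<Prod>i<d. \<Sum>j=1..n. sine_mode n j (v ! i) * sine_mode n j (x ! i))"
    unfolding grid_mode_def prod.distrib[symmetric] by (rule sum_grid_points_prod)
  also have "\<dots> = (\<Prod>i<d. if v ! i = x ! i then real (Suc n) / 2 else 0)"
    by (intro prod.cong refl sine_mode_orthogonal grid_points_nth[OF assms(1)] grid_points_nth[OF assms(2)]) auto
  finally have e: "(\<Sum>k\<in>grid_points d n. grid_mode d n k v * grid_mode d n k x) = \<dots>" .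
  show ?thesis
  proof (cases "x = v")
    case True
    then show ?thesis unfolding e by (simp flip: power_mult_distrib)
  next
    case False
    then obtain i where "i < d" "x ! i \<noteq> v ! i"
      using assms by (auto simp: grid_points_def list_eq_iff_nth_eq)
    then have "(\<Prod>i<d. if v ! i = x ! i then real (Suc n) / 2 else 0) = 0"
      by (intro prod_zero bexI[of _ i]) auto
    then show ?thesis unfolding e using False by simp
  qed
qed

lemma grid_mode_one: "grid_mode d n (replicate d 1) x = (\<Prod>i<d. sine_mode n 1 (x ! i))"
  by (simp add: grid_mode_def)

lemma grid_mode_one_pos:
  assumes "x \<in> grid_points d n"
  shows "grid_mode d n (replicate d 1) x > 0"
  unfolding grid_mode_one using grid_points_nth[OF assms] by (intro prod_pos sine_mode_pos ballI) auto

lemma abs_grid_mode_le: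
  assumes "x \<in> grid_points d n"
  shows "\<bar>grid_mode d n k x\<bar> \<le> (\<Prod>i<d. real (k ! i)) * grid_mode d n (replicate d 1) x"
proof -
  have "\<bar>grid_mode d n k x\<bar> \<le> (\<Prod>i<d. real (k ! i) * sine_mode n 1 (x ! i))"
    unfolding grid_mode_def abs_prod
    using grid_points_nth[OF assms] by (intro prod_mono conjI abs_sine_mode_le) auto
  then show ?thesis by (simp only: grid_mode_one prod.distrib)
qed

lemma grid_freq_ge:
  assumes "k \<in> grid_points d n"
  shows "(\<Sum>i<d. (real (k ! i))\<^sup>2) / (real (Suc n))\<^sup>2 \<le> grid_freq d n k"
  unfolding grid_freq_def sum_divide_distrib power_divide[symmetric]
  using grid_points_nth[OF assms] by (intro sum_mono sin_sq_half_ge) auto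

section \<open>Harmonic measure of a corner\<close>

text \<open>\<open>transfer \<mu> m = sinh (m * \<theta>) / sinh \<theta>\<close> where \<open>2 * cosh \<theta> = 2 + \<mu>\<close>.\<close>

fun transfer :: "real \<Rightarrow> nat \<Rightarrow> real" where
  "transfer \<mu> 0 = 0"
| "transfer \<mu> (Suc 0) = 1"
| "transfer \<mu> (Suc (Suc m)) = (2 + \<mu>) * transfer \<mu> (Suc m) - transfer \<mu> m"

lemma discrete_convex_nonneg:
  fixes f :: "nat \<Rightarrow> real"
  assumes "0 \<le> f 0" "f 0 \<le> f 1" "\<And>m. 2 * f (Suc m) \<le> f (Suc (Suc m)) + f m"
  shows "0 \<le> f m"
proof -
  have "f m \<le> f (Suc m) \<and> 0 \<le> f m"
  proof (induction m)
    case (Suc m)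
    then show ?case using assms(3)[of m] by linarith
  qed (use assms in auto)
  then show ?thesis by simp
qed

text \<open>\<open>transfer \<mu> m\<close> is the Chebyshev polynomial U_(m-1) at 1 + \<mu>/2, and
  the left side is one term of its expansion in powers of \<mu>. By Pascal's rule the second
  difference of this term in \<open>m\<close> is \<mu> times the preceding term, matching the
  recurrence of \<open>transfer\<close>; so induction on \<open>J\<close> makes the difference
  discretely convex.\<close>

lemma transfer_ge_binomial:
  assumes "0 \<le> \<mu>"
  shows "real ((m + J) choose (2 * J + 1)) * \<mu> ^ J \<le> transfer \<mu> m"
proof (induction J arbitrary: m)
  case 0
  have "real m \<le> transfer \<mu> m \<and> transfer \<mu> m + 1 \<le> transfer \<mu> (Suc m)"
  proof (induction m)
    case (Suc m)
    have "0 \<le> \<mu> * transfer \<mu> (Suc m)" using assms Suc by (intro mult_nonneg_nonneg) auto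
    then show ?case using Suc by (simp add: of_nat_Suc distrib_right)
  qed auto
  then show ?case by simp
next
  case (Suc J)
  define V where "V m = real ((m + Suc J) choose (2 * Suc J + 1)) * \<mu> ^ Suc J" for m
  have V: "V (Suc (Suc m)) + V m - 2 * V (Suc m)
      = \<mu> * (real ((Suc m + J) choose (2 * J + 1)) * \<mu> ^ J)" for m
  proof -
    have "real ((Suc (Suc m) + Suc J) choose (2 * Suc J + 1)) + real ((m + Suc J) choose (2 * Suc J + 1))
        - 2 * real ((Suc m + Suc J) choose (2 * Suc J + 1)) = real ((Suc m + J) choose (2 * J + 1))"
      by simp
    then show ?thesis unfolding V_def by (simp add: algebra_simps flip: distrib_right left_diff_distrib)
  qed
  have "0 \<le> transfer \<mu> m - V m" for m
  proof (rule discrete_convex_nonneg)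
    have "V 0 = 0" "V 1 = 0" by (simp_all add: V_def binomial_eq_0)
    then show "0 \<le> transfer \<mu> 0 - V 0" "transfer \<mu> 0 - V 0 \<le> transfer \<mu> 1 - V 1" by simp_all
    fix m
    have "\<mu> * (real ((Suc m + J) choose (2 * J + 1)) * \<mu> ^ J) \<le> \<mu> * transfer \<mu> (Suc m)"
      using Suc.IH[of "Suc m"] assms by (rule mult_left_mono)
    then show "2 * (transfer \<mu> (Suc m) - V (Suc m))
        \<le> transfer \<mu> (Suc (Suc m)) - V (Suc (Suc m)) + (transfer \<mu> m - V m)"
      using V[of m] by (simp add: algebra_simps)
  qed
  then show ?case by (simp add: V_def)
qed

lemma transfer_ge:
  assumes "0 \<le> \<mu>" "J < m"
  shows "(real m / real (2 * J + 1)) ^ (2 * J + 1) * \<mu> ^ J \<le> transfer \<mu> m"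
proof -
  have "(real m / real (2 * J + 1)) ^ (2 * J + 1) \<le> (real (m + J) / real (2 * J + 1)) ^ (2 * J + 1)"
    by (intro power_mono divide_right_mono) auto
  also have "\<dots> \<le> real ((m + J) choose (2 * J + 1))"
    using assms(2) by (intro binomial_ge_n_over_k_pow_k) auto
  finally show ?thesis
    using transfer_ge_binomial[OF assms(1), of m J] assms(1)
    by (meson mult_right_mono order_trans zero_le_power)
qed

lemma grid_freq_one_pos:
  assumes "0 < d"
  shows "grid_freq d n (replicate d 1) > 0"
proof -
  have "sin (pi / (2 * real (Suc n))) > 0"
    by (intro sin_gt_zero) (auto simp: field_simps of_nat_Suc add_pos_nonneg)
  then show ?thesis using assms by (simp add: grid_freq_def)
qed

text \<open>A minimum principle, by minimising the quotient of \<open>h\<close> and the lowest mode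
  \<open>u\<close>. At a minimiser \<open>x\<close>, \<open>m * u\<close> lies below
  \<open>h\<close> on the neighbours and meets it at \<open>x\<close>; as \<open>u\<close> is
  strictly superharmonic, \<open>m\<close> cannot be negative.\<close>

lemma grid_superharmonic_nonneg:
  assumes "0 < d"
    and super: "\<And>x. x \<in> grid_points d n \<Longrightarrow> (\<Sum>y\<in>grid_nbrs d n x. h y) \<le> 2 * real d * h x"
    and z: "z \<in> grid_points d n"
  shows "0 \<le> h z"
proof -
  define u where "u = grid_mode d n (replicate d 1)"
  have u: "u x > 0" if "x \<in> grid_points d n" for x
    using grid_mode_one_pos[OF that] by (simp add: u_def)
  obtain x where x: "x \<in> grid_points d n" "\<And>y. y \<in> grid_points d n \<Longrightarrow> h x / u x \<le> h y / u y"
    using ex_min_if_finite[OF finite_imageI[OF finite_grid_points[of d n]], of "\<lambda>x. h x / u x"] z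
    by (fastforce simp: not_less)
  define m where "m = h x / u x"
  have hx: "h x = m * u x" using u[OF x(1)] by (simp add: m_def)
  have "m * (2 * real d - 4 * grid_freq d n (replicate d 1)) * u x = (\<Sum>y\<in>grid_nbrs d n x. m * u y)"
    unfolding u_def using sum_nbrs_grid_mode[OF x(1), of "replicate d 1"]
    by (simp flip: sum_distrib_left)
  also have "\<dots> \<le> (\<Sum>y\<in>grid_nbrs d n x. h y)"
    using x(2) u by (intro sum_mono) (auto simp: m_def[symmetric] grid_nbrs_def pos_le_divide_eq)
  also have "\<dots> \<le> 2 * real d * (m * u x)" using super[OF x(1)] by (simp add: hx)
  finally have "0 \<le> m * (4 * grid_freq d n (replicate d 1) * u x)" by (simp add: algebra_simps)
  then have "0 \<le> m"
    using grid_freq_one_pos[OF assms(1), of n] u[OF x(1)]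
    by (meson mult_neg_pos mult_pos_pos not_le zero_less_numeral)
  also have "m \<le> h z / u z" using x(2)[OF z] by (simp add: m_def)
  finally show ?thesis using u[OF z] by (simp add: zero_le_divide_iff)
qed

text \<open>The harmonic measure of the boundary point \<open>(0, 1, \<dots>, 1)\<close>, by separation of variables.\<close>

definition corner_measure :: "nat \<Rightarrow> nat \<Rightarrow> nat list \<Rightarrow> real" where
  "corner_measure e n x = (2 / real (Suc n)) ^ e * (\<Sum>k\<in>grid_points e n.
     grid_mode e n k (replicate e 1) * grid_mode e n k (tl x)
       * (transfer (4 * grid_freq e n k) (Suc n - hd x) / transfer (4 * grid_freq e n k) (Suc n)))"

lemma grid_freq_nonneg: "0 \<le> grid_freq d n k"
  unfolding grid_freq_def by (intro sum_nonneg) auto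

lemma transfer_pos: "0 \<le> \<mu> \<Longrightarrow> 0 < m \<Longrightarrow> 0 < transfer \<mu> m"
  using transfer_ge_binomial[of \<mu> m 0] by simp

lemma replicate_in_grid_points: "1 \<le> a \<Longrightarrow> a \<le> n \<Longrightarrow> replicate e a \<in> grid_points e n"
  by (auto simp: grid_points_def)

lemma corner_measure_nbrs:
  assumes x: "x \<in> grid_points (Suc e) n"
  shows "(\<Sum>y\<in>grid_nbrs (Suc e) n x. corner_measure e n y)
    = 2 * real (Suc e) * corner_measure e n x - (if x = replicate (Suc e) 1 then 1 else 0)"
proof -
  obtain j x' where jx: "x = j # x'" "1 \<le> j" "j \<le> n" "x' \<in> grid_points e n"
    using x by (auto simp: grid_points_Suc)
  define N where "N = Suc n"
  \<comment> \<open>Coordinate 0 carries the hyperbolic factor, zero at the face \<open>N\<close>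
    but not at the face 0. Its surplus \<open>4 * grid_freq e n k\<close> in \<open>c\<close>
    offsets the deficit of the sine factors, so that each product is harmonic away from the face
    0.\<close>
  define \<phi> where "\<phi> k i a = (case i of 0 \<Rightarrow> transfer (4 * grid_freq e n k) (N - a)
      | Suc i' \<Rightarrow> sine_mode n (k ! i') a)" for k i a
  define c where "c k i = (case i of 0 \<Rightarrow> 2 + 4 * grid_freq e n k
      | Suc i' \<Rightarrow> 2 * cos (pi * real (k ! i') / real (Suc n)))" for k i
  have prod_\<phi>: "(\<Prod>i<Suc e. \<phi> k i (y ! i)) = grid_mode e n k (tl y) * transfer (4 * grid_freq e n k) (N - hd y)"
    if y: "y \<in> grid_points (Suc e) n" for k y
  proof -
    obtain j y' where "y = j # y'" using y by (auto simp: grid_points_Suc)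
    then show ?thesis
      by (simp add: prod.lessThan_Suc_shift \<phi>_def grid_mode_def del: prod.lessThan_Suc)
  qed
  have sum_c: "(\<Sum>i<Suc e. c k i) = 2 * real (Suc e)" for k
    unfolding sum.lessThan_Suc_shift c_def
    by (simp add: two_cos_sine_freq sum_subtractf grid_freq_def sum_distrib_left of_nat_Suc[of e] del: sum.lessThan_Suc)
  have bdry: "(\<Sum>i<Suc e. if x ! i = 1 then \<phi> k i 0 * (\<Prod>i'\<in>{..<Suc e} - {i}. \<phi> k i' (x ! i')) else 0)
      = (if j = 1 then transfer (4 * grid_freq e n k) N * grid_mode e n k x' else 0)" for k
  proof -
    have "{..<Suc e} - {0} = Suc ` {..<e}" by (auto simp: lessThan_Suc_eq_insert_0)
    then have "(\<Prod>i'\<in>{..<Suc e} - {0}. \<phi> k i' (x ! i')) = grid_mode e n k x'"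
      by (simp add: prod.reindex \<phi>_def grid_mode_def jx(1))
    then show ?thesis
      unfolding sum.lessThan_Suc_shift by (simp add: \<phi>_def jx(1) cong: if_cong)
  qed
  have nbrs: "(\<Sum>y\<in>grid_nbrs (Suc e) n x. \<Prod>i<Suc e. \<phi> k i (y ! i))
      = 2 * real (Suc e) * (\<Prod>i<Suc e. \<phi> k i (x ! i))
        - (if j = 1 then transfer (4 * grid_freq e n k) N * grid_mode e n k x' else 0)" for k
    unfolding sum_c[of k, symmetric] bdry[of k, symmetric]
  proof (rule sum_grid_nbrs_prod[OF x])
    show "\<phi> k i (Suc n) = 0" for i by (simp add: \<phi>_def N_def split: nat.split)
    fix i a assume a: "1 \<le> a" "a \<le> n"
    show "\<phi> k i (Suc a) + \<phi> k i (a - 1) = c k i * \<phi> k i a"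
    proof (cases i)
      case 0
      obtain r where r: "N - a = Suc r" "N - Suc a = r" "N - (a - 1) = Suc (Suc r)"
        using a by (intro that[of "N - Suc a"]) (auto simp: N_def)
      show ?thesis by (simp add: 0 \<phi>_def c_def r del: One_nat_def)
    next
      case (Suc i')
      then show ?thesis using sine_mode_neighbours[OF a(1)] by (simp add: \<phi>_def c_def)
    qed
  qed
  define w where "w k = (2 / real (Suc n)) ^ e * (grid_mode e n k (replicate e 1)
      / transfer (4 * grid_freq e n k) N)" for k
  have cm: "corner_measure e n y = (\<Sum>k\<in>grid_points e n. w k * (\<Prod>i<Suc e. \<phi> k i (y ! i)))"
    if "y \<in> grid_points (Suc e) n" for y
    unfolding corner_measure_def prod_\<phi>[OF that] w_def N_def
    by (simp add: sum_distrib_left mult_ac)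
  have "(\<Sum>y\<in>grid_nbrs (Suc e) n x. corner_measure e n y)
      = (\<Sum>y\<in>grid_nbrs (Suc e) n x. \<Sum>k\<in>grid_points e n. w k * (\<Prod>i<Suc e. \<phi> k i (y ! i)))"
    by (intro sum.cong cm) (auto simp: grid_nbrs_def)
  also have "\<dots> = (\<Sum>k\<in>grid_points e n. w k * (\<Sum>y\<in>grid_nbrs (Suc e) n x. \<Prod>i<Suc e. \<phi> k i (y ! i)))"
    by (subst sum.swap) (simp only: sum_distrib_left)
  also have "\<dots> = 2 * real (Suc e) * corner_measure e n x
      - (\<Sum>k\<in>grid_points e n. w k * (if j = 1 then transfer (4 * grid_freq e n k) N * grid_mode e n k x' else 0))"
    unfolding nbrs cm[OF x] sum_distrib_left right_diff_distrib sum_subtractf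
    by (simp only: mult.left_commute)
  \<comment> \<open>Dividing by \<open>transfer\<close> at \<open>N\<close> has normalised the
    hyperbolic factor to 1 at the face 0, so the completeness sum remains.\<close>
  also have "(\<Sum>k\<in>grid_points e n. w k * (if j = 1 then transfer (4 * grid_freq e n k) N * grid_mode e n k x' else 0))
      = (if j = 1 then (2 / real (Suc n)) ^ e
          * (\<Sum>k\<in>grid_points e n. grid_mode e n k (replicate e 1) * grid_mode e n k x') else 0)"
    unfolding sum_distrib_left w_def
    using transfer_pos[of "4 * grid_freq e n k" N for k] grid_freq_nonneg[of e n]
    by (auto intro!: sum.cong simp: N_def less_imp_neq[symmetric])
  also have "\<dots> = (if x = replicate (Suc e) 1 then 1 else 0)"
  proof -
    have "replicate e 1 \<in> grid_points e n" using jx by (intro replicate_in_grid_points) auto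
    from grid_mode_complete[OF this jx(4)] show ?thesis unfolding jx(1) by auto
  qed
  finally show ?thesis .
qed

text \<open>The issue is summability over \<open>k\<close>. The two mode values cost the square of
  the product P of the \<open>k ! i\<close>; bounding the denominator below by a multiple of P^4
  leaves 1/P^2, whose sum converges without a logarithm.\<close>

lemma corner_measure_far_le:
  assumes "n \<ge> 2 * e" "n \<ge> 1"
  shows "corner_measure e n (replicate (Suc e) n)
    \<le> (4 * pi\<^sup>2) ^ e * real (4 * e + 1) ^ (4 * e + 1) / real n ^ (3 * e + 1)"
proof -
  define N where "N = real (Suc n)"
  define M where "M = real (4 * e + 1) ^ (4 * e + 1)"
  have N: "N > 0" and M: "M > 0" by (simp_all add: N_def M_def)
  have mode: "\<bar>grid_mode e n k (replicate e a)\<bar> \<le> (\<Prod>i<e. real (k ! i)) * (pi / N) ^ e"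
    if a: "a = 1 \<or> a = n" for a k
  proof -
    have aa: "1 \<le> a" "a \<le> n" using a assms by auto
    have "\<bar>grid_mode e n k (replicate e a)\<bar> \<le> (\<Prod>i<e. real (k ! i)) * grid_mode e n (replicate e 1) (replicate e a)"
      by (rule abs_grid_mode_le[OF replicate_in_grid_points[OF aa]])
    also have "grid_mode e n (replicate e 1) (replicate e a) = sine_mode n 1 a ^ e"
      unfolding grid_mode_one by (simp cong: prod.cong_simp)
    also have "(\<Prod>i<e. real (k ! i)) * sine_mode n 1 a ^ e \<le> (\<Prod>i<e. real (k ! i)) * (pi / N) ^ e"
      using a sine_mode_last_le[of n] sine_mode_pos[OF aa] assms
      by (intro mult_left_mono power_mono prod_nonneg) (auto simp: N_def)
    finally show ?thesis .
  qed
  \<comment> \<open>\<open>transfer_ge\<close> with \<open>J = 2 * e\<close> yields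
    \<open>S ^ (2 * e)\<close> for the sum of squares \<open>S\<close>, and each squared index is at
    most \<open>S\<close>; hence the fourth power of the product. \<open>n \<ge> 2 * e\<close> makes
    this \<open>J\<close> admissible.\<close>
  have tr: "N * (\<Prod>i<e. real (k ! i)) ^ 4 / M \<le> transfer (4 * grid_freq e n k) (Suc n)"
    if k: "k \<in> grid_points e n" for k
  proof -
    define S where "S = (\<Sum>i<e. (real (k ! i))\<^sup>2)"
    have "(\<Prod>i<e. real (k ! i)) ^ 4 = ((\<Prod>i<e. (real (k ! i))\<^sup>2))\<^sup>2"
      by (simp flip: prod_power_distrib power_mult)
    also have "\<dots> \<le> (S ^ e)\<^sup>2"
    proof (intro power_mono prod_nonneg)
      have "(\<Prod>i<e. (real (k ! i))\<^sup>2) \<le> (\<Prod>i<e. S)"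
        unfolding S_def by (intro prod_mono conjI member_le_sum) auto
      then show "(\<Prod>i<e. (real (k ! i))\<^sup>2) \<le> S ^ e" by simp
    qed auto
    finally have "(\<Prod>i<e. real (k ! i)) ^ 4 \<le> S ^ (2 * e)" by (simp add: power_mult mult.commute)
    then have "N * (\<Prod>i<e. real (k ! i)) ^ 4 / M \<le> N * S ^ (2 * e) / M"
      using N M by (intro divide_right_mono mult_left_mono) auto
    also have "\<dots> = (N / real (4 * e + 1)) ^ (4 * e + 1) * (S / N\<^sup>2) ^ (2 * e)"
    proof -
      have "N ^ (4 * e + 1) = N * (N\<^sup>2) ^ (2 * e)" by (simp flip: power_mult)
      then show ?thesis using N by (simp add: M_def power_divide)
    qed
    also have "\<dots> \<le> (N / real (4 * e + 1)) ^ (4 * e + 1) * (4 * grid_freq e n k) ^ (2 * e)"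
    proof (intro mult_left_mono power_mono)
      have "S / N\<^sup>2 \<le> grid_freq e n k" using grid_freq_ge[OF k] by (simp add: S_def N_def)
      then show "S / N\<^sup>2 \<le> 4 * grid_freq e n k" using grid_freq_nonneg[of e n k] by linarith
      show "0 \<le> S / N\<^sup>2" by (simp add: S_def sum_nonneg)
      show "0 \<le> (N / real (4 * e + 1)) ^ (4 * e + 1)" using N by simp
    qed
    also have "\<dots> \<le> transfer (4 * grid_freq e n k) (Suc n)"
      using transfer_ge[of "4 * grid_freq e n k" "2 * e" "Suc n"] grid_freq_nonneg[of e n k] assms
      by (simp add: N_def)
    finally show ?thesis .
  qed
  have summand: "grid_mode e n k (replicate e 1) * grid_mode e n k (replicate e n)
      * (1 / transfer (4 * grid_freq e n k) (Suc n))
      \<le> ((pi / N) ^ e)\<^sup>2 * (M / N) * (\<Prod>i<e. 1 / (real (k ! i))\<^sup>2)"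
    if k: "k \<in> grid_points e n" for k
  proof -
    define P where "P = (\<Prod>i<e. real (k ! i))"
    have P: "P > 0" unfolding P_def using grid_points_nth[OF k] by (intro prod_pos) force
    have "grid_mode e n k (replicate e 1) * grid_mode e n k (replicate e n)
      \<le> \<bar>grid_mode e n k (replicate e 1)\<bar> * \<bar>grid_mode e n k (replicate e n)\<bar>"
      by (simp flip: abs_mult)
    also have "\<dots> \<le> (P * (pi / N) ^ e) * (P * (pi / N) ^ e)"
      unfolding P_def by (intro mult_mono' mode) auto
    finally have "grid_mode e n k (replicate e 1) * grid_mode e n k (replicate e n)
      * (1 / transfer (4 * grid_freq e n k) (Suc n))
      \<le> (P * (pi / N) ^ e) * (P * (pi / N) ^ e) * (1 / (N * P ^ 4 / M))"
    proof (rule order_trans[OF mult_right_mono mult_left_mono])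
      have pos: "0 < transfer (4 * grid_freq e n k) (Suc n)"
        using grid_freq_nonneg[of e n k] by (intro transfer_pos) auto
      then show "0 \<le> 1 / transfer (4 * grid_freq e n k) (Suc n)" by simp
      show "1 / transfer (4 * grid_freq e n k) (Suc n) \<le> 1 / (N * P ^ 4 / M)"
        using tr[OF k] pos P N M unfolding P_def[symmetric]
        by (intro divide_left_mono mult_pos_pos divide_pos_pos) auto
    qed (use P N in auto)
    also have "\<dots> = ((pi / N) ^ e)\<^sup>2 * (M / N) * (1 / P\<^sup>2)"
      using P N M by (simp add: field_simps power2_eq_square power4_eq_xxxx)
    also have "1 / P\<^sup>2 = (\<Prod>i<e. 1 / (real (k ! i))\<^sup>2)"
      by (simp add: P_def prod_dividef flip: prod_power_distrib)
    finally show ?thesis .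
  qed
  \<comment> \<open>At the far corner \<open>Suc n - hd x\<close> is 1, so the numerator
    \<open>transfer _ 1\<close> equals 1.\<close>
  have "corner_measure e n (replicate (Suc e) n) = (2 / N) ^ e * (\<Sum>k\<in>grid_points e n.
      grid_mode e n k (replicate e 1) * grid_mode e n k (replicate e n)
        * (1 / transfer (4 * grid_freq e n k) (Suc n)))"
    by (simp add: corner_measure_def N_def Suc_diff_le)
  also have "\<dots> \<le> (2 / N) ^ e * (\<Sum>k\<in>grid_points e n.
      ((pi / N) ^ e)\<^sup>2 * (M / N) * (\<Prod>i<e. 1 / (real (k ! i))\<^sup>2))"
    using N by (intro mult_left_mono sum_mono summand) auto
  also have "\<dots> = (2 / N) ^ e * (((pi / N) ^ e)\<^sup>2 * (M / N) * (\<Sum>j=1..n. 1 / (real j)\<^sup>2) ^ e)"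
    unfolding sum_distrib_left[symmetric] sum_grid_points_prod[of "\<lambda>i j. 1 / (real j)\<^sup>2"]
    by simp
  also have "\<dots> \<le> (2 / N) ^ e * (((pi / N) ^ e)\<^sup>2 * (M / N) * 2 ^ e)"
  proof (rule mult_left_mono[OF mult_left_mono])
    show "(\<Sum>j=1..n. 1 / (real j)\<^sup>2) ^ e \<le> 2 ^ e"
      by (intro power_mono sum_inverse_squares_le sum_nonneg) simp
  qed (use N M in simp_all)
  also have "\<dots> = (4 * pi\<^sup>2) ^ e * M / N ^ (3 * e + 1)"
  proof -
    have "((pi / N) ^ e)\<^sup>2 = ((pi / N)\<^sup>2) ^ e" by (simp only: power_mult[symmetric] mult.commute)
    then have "(2 / N) ^ e * (((pi / N) ^ e)\<^sup>2 * (M / N) * 2 ^ e)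
        = (2 / N * (pi / N)\<^sup>2 * 2) ^ e * (M / N)"
      by (simp only: power_mult_distrib mult_ac)
    also have "2 / N * (pi / N)\<^sup>2 * 2 = 4 * pi\<^sup>2 / N ^ 3"
      by (simp add: power2_eq_square power3_eq_cube)
    also have "(4 * pi\<^sup>2 / N ^ 3) ^ e * (M / N) = (4 * pi\<^sup>2) ^ e * M / N ^ (3 * e + 1)"
      by (simp only: power_divide power_add power_mult power_one_right times_divide_times_eq)
    finally show ?thesis .
  qed
  also have "\<dots> \<le> (4 * pi\<^sup>2) ^ e * M / real n ^ (3 * e + 1)"
    using M assms by (intro divide_left_mono power_mono mult_nonneg_nonneg mult_pos_pos) (auto simp: N_def)
  finally show ?thesis by (simp add: M_def)
qed

section \<open>Occupation times of the lazy walk\<close>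

lemma grid_freq_le: "grid_freq d n k \<le> real d"
proof -
  have "grid_freq d n k \<le> (\<Sum>i<d. 1)"
    unfolding grid_freq_def by (intro sum_mono) (simp add: abs_square_le_1)
  then show ?thesis by simp
qed

lemma grid_freq_pos:
  assumes "k \<in> grid_points d n" "0 < d"
  shows "0 < grid_freq d n k"
proof -
  have "0 < (\<Sum>i<d. (real (k ! i))\<^sup>2)"
    using grid_points_nth[OF assms(1)] assms(2) by (intro sum_pos) force+
  then show ?thesis using grid_freq_ge[OF assms(1)]
    by (meson divide_pos_pos less_le_trans of_nat_0_less_iff zero_less_Suc zero_less_power)
qed

text \<open>With probability 1/2 the walk stays put, otherwise it uses one of \<open>2 * d\<close>
  edges; mass sent to the sink is dropped, as \<open>grid_nbrs\<close> omits it. Laziness puts all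
  eigenvalues in [0, 1].\<close>

primrec lazy_walk :: "nat \<Rightarrow> nat \<Rightarrow> nat list \<Rightarrow> nat \<Rightarrow> nat list \<Rightarrow> real" where
  "lazy_walk d n v 0 x = (if x = v then 1 else 0)"
| "lazy_walk d n v (Suc t) x
    = lazy_walk d n v t x / 2 + (\<Sum>y\<in>grid_nbrs d n x. lazy_walk d n v t y) / (4 * real d)"

lemma lazy_walk_nonneg: "0 \<le> lazy_walk d n v t x"
  by (induction t arbitrary: x) (auto intro!: add_nonneg_nonneg divide_nonneg_nonneg sum_nonneg)

definition walk_eigenvalue :: "nat \<Rightarrow> nat \<Rightarrow> nat list \<Rightarrow> real" where
  "walk_eigenvalue d n k = 1 - grid_freq d n k / real d"

lemma lazy_walk_spectral:
  assumes "0 < d" "v \<in> grid_points d n" "x \<in> grid_points d n"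
  shows "lazy_walk d n v t x = (2 / real (Suc n)) ^ d
    * (\<Sum>k\<in>grid_points d n. grid_mode d n k v * grid_mode d n k x * walk_eigenvalue d n k ^ t)"
  using assms(3)
proof (induction t arbitrary: x)
  case 0
  then show ?case using grid_mode_complete[OF assms(2), of x] by simp
next
  case (Suc t)
  define c where "c = (2 / real (Suc n)) ^ d"
  have nb: "y \<in> grid_points d n" if "y \<in> grid_nbrs d n x" for y
    using that by (simp add: grid_nbrs_def)
  have "(\<Sum>y\<in>grid_nbrs d n x. lazy_walk d n v t y)
      = (\<Sum>y\<in>grid_nbrs d n x. \<Sum>k\<in>grid_points d n.
          c * (grid_mode d n k v * walk_eigenvalue d n k ^ t) * grid_mode d n k y)"
    using Suc.IH[OF nb] by (intro sum.cong refl) (simp add: c_def sum_distrib_left mult_ac)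
  also have "\<dots> = (\<Sum>k\<in>grid_points d n. c * (grid_mode d n k v * walk_eigenvalue d n k ^ t)
      * ((2 * real d - 4 * grid_freq d n k) * grid_mode d n k x))"
    by (subst sum.swap) (simp add: sum_nbrs_grid_mode[OF Suc.prems] flip: sum_distrib_left)
  finally have nbrs: "(\<Sum>y\<in>grid_nbrs d n x. lazy_walk d n v t y) = \<dots>" .
  have "lazy_walk d n v (Suc t) x
      = (\<Sum>k\<in>grid_points d n. c * (grid_mode d n k v * walk_eigenvalue d n k ^ t) * grid_mode d n k x / 2
        + c * (grid_mode d n k v * walk_eigenvalue d n k ^ t)
          * ((2 * real d - 4 * grid_freq d n k) * grid_mode d n k x) / (4 * real d))"
    by (simp add: Suc.IH[OF Suc.prems] nbrs sum.distrib c_def[symmetric] sum_distrib_left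
        sum_divide_distrib mult_ac)
  also have "\<dots> = (\<Sum>k\<in>grid_points d n. c * (grid_mode d n k v * grid_mode d n k x * walk_eigenvalue d n k ^ Suc t))"
  proof (intro sum.cong refl)
    fix k
    have e: "walk_eigenvalue d n k = 1 / 2 + (2 * real d - 4 * grid_freq d n k) / (4 * real d)"
      using assms(1) by (simp add: walk_eigenvalue_def field_simps)
    define w where "w = walk_eigenvalue d n k ^ t"
    have p: "walk_eigenvalue d n k ^ Suc t = (1 / 2 + (2 * real d - 4 * grid_freq d n k) / (4 * real d)) * w"
      by (simp add: w_def flip: e)
    show "c * (grid_mode d n k v * walk_eigenvalue d n k ^ t) * grid_mode d n k x / 2
        + c * (grid_mode d n k v * walk_eigenvalue d n k ^ t)
          * ((2 * real d - 4 * grid_freq d n k) * grid_mode d n k x) / (4 * real d)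
        = c * (grid_mode d n k v * grid_mode d n k x * walk_eigenvalue d n k ^ Suc t)"
      unfolding p w_def[symmetric] distrib_right distrib_left by (simp add: mult_ac)
  qed
  finally show ?case by (simp only: c_def sum_distrib_left)
qed

definition occupation :: "nat \<Rightarrow> nat \<Rightarrow> nat list \<Rightarrow> nat \<Rightarrow> nat list \<Rightarrow> real" where
  "occupation d n v T x = (\<Sum>t<T. lazy_walk d n v t x)"

text \<open>The recursion telescopes in time: the Laplacian of the occupation is
  \<open>4 * d\<close> times the initial minus the final distribution. Off \<open>v\<close> only the
  final one is left, with the sign wanted.\<close>

lemma occupation_nbrs:
  assumes "0 < d"
  shows "(\<Sum>y\<in>grid_nbrs d n x. occupation d n v T y)
    = 2 * real d * occupation d n v T x
      + 4 * real d * (lazy_walk d n v T x - (if x = v then 1 else 0))"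
proof (induction T)
  case (Suc T)
  have "(\<Sum>y\<in>grid_nbrs d n x. lazy_walk d n v T y)
      = 4 * real d * lazy_walk d n v (Suc T) x - 2 * real d * lazy_walk d n v T x"
    using assms by (simp add: field_simps)
  then show ?case
    using Suc by (simp add: occupation_def sum.distrib algebra_simps del: lazy_walk.simps(2))
qed (simp add: occupation_def)

lemma abs_sum_grid_mode_le:
  assumes "k \<in> grid_points d n"
  shows "\<bar>\<Sum>x\<in>grid_points d n. grid_mode d n k x\<bar> \<le> real (Suc n) ^ d / (\<Prod>i<d. real (k ! i))"
proof -
  have "(\<Sum>x\<in>grid_points d n. grid_mode d n k x) = (\<Prod>i<d. \<Sum>j=1..n. sine_mode n (k ! i) j)"
    unfolding grid_mode_def by (rule sum_grid_points_prod)
  also have "\<bar>\<dots>\<bar> \<le> (\<Prod>i<d. real (Suc n) / real (k ! i))"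
    unfolding abs_prod using grid_points_nth[OF assms]
    by (intro prod_mono conjI abs_sum_sine_mode_le) auto
  finally show ?thesis by (simp add: prod_dividef)
qed

text \<open>The factors k_i from the comparison at \<open>v\<close> cancel the factors 1/k_i of the
  total mass, leaving the inverse frequency to be summed. It is at most
  \<open>N\<^sup>2 / (k ! 0 * k ! 1)\<close>, so two coordinates give harmonic sums and the others a
  factor \<open>n\<close> each. Summing the full geometric series makes the bound uniform in
  \<open>T\<close>.\<close>

lemma sum_occupation_le:
  assumes "2 \<le> d" "v \<in> grid_points d n"
  shows "(\<Sum>x\<in>grid_points d n. occupation d n v T x)
    \<le> 2 ^ d * real d * (real (Suc n))\<^sup>2 * (\<Sum>j=1..n. 1 / real j)\<^sup>2 * real n ^ (d - 2)
      * grid_mode d n (replicate d 1) v"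
proof -
  define u where "u = grid_mode d n (replicate d 1) v"
  define N where "N = real (Suc n)"
  have u: "u > 0" and N: "N > 0" using grid_mode_one_pos[OF assms(2)] by (simp_all add: u_def N_def)
  have d: "0 < d" using assms(1) by simp
  have geo: "(\<Sum>t<T. walk_eigenvalue d n k ^ t) \<le> real d * N\<^sup>2 * (\<Prod>i<d. if i < 2 then 1 / real (k ! i) else 1)"
    and geo_nonneg: "0 \<le> (\<Sum>t<T. walk_eigenvalue d n k ^ t)"
    if k: "k \<in> grid_points d n" for k
  proof -
    define \<rho> where "\<rho> = walk_eigenvalue d n k"
    have f: "0 < grid_freq d n k" by (rule grid_freq_pos[OF k d])
    have \<rho>: "0 \<le> \<rho>" "\<rho> < 1" "1 - \<rho> = grid_freq d n k / real d"
      using f grid_freq_le[of d n k] d by (auto simp: \<rho>_def walk_eigenvalue_def)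
    show "0 \<le> (\<Sum>t<T. walk_eigenvalue d n k ^ t)" using \<rho>(1) by (simp add: \<rho>_def sum_nonneg)
    have k01: "1 \<le> k ! 0" "1 \<le> k ! 1"
      using grid_points_nth[OF k, of 0] grid_points_nth[OF k, of 1] assms(1) by auto
    define a b where "a = real (k ! 0)" and "b = real (k ! 1)"
    have ab: "a > 0" "b > 0" using k01 by (auto simp: a_def b_def)
    have "a * b \<le> a\<^sup>2 + b\<^sup>2"
      using sum_squares_bound[of a b] mult_pos_pos[OF ab] by linarith
    also have "\<dots> = (\<Sum>i\<in>{0, 1}. (real (k ! i))\<^sup>2)" by (simp add: a_def b_def)
    also have "\<dots> \<le> (\<Sum>i<d. (real (k ! i))\<^sup>2)" using assms(1) by (intro sum_mono2) auto
    finally have "a * b / N\<^sup>2 \<le> (\<Sum>i<d. (real (k ! i))\<^sup>2) / N\<^sup>2" by (intro divide_right_mono) auto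
    also have "\<dots> \<le> grid_freq d n k" using grid_freq_ge[OF k] by (simp add: N_def)
    finally have freq: "a * b / N\<^sup>2 \<le> grid_freq d n k" .
    have "(\<Sum>t<T. \<rho> ^ t) = (1 - \<rho> ^ T) / (1 - \<rho>)"
      using \<rho>(2) by (simp add: sum_gp_strict)
    also have "\<dots> \<le> 1 / (1 - \<rho>)" using \<rho> by (intro divide_right_mono) auto
    also have "\<dots> = real d / grid_freq d n k" using \<rho>(3) by simp
    also have "\<dots> \<le> real d / (a * b / N\<^sup>2)" using freq ab N f by (intro divide_left_mono) auto
    also have "\<dots> = real d * N\<^sup>2 * (1 / a * (1 / b))" by simp
    also have "1 / a * (1 / b) = (\<Prod>i\<in>{0, 1}. if i < 2 then 1 / real (k ! i) else 1)"
      by (simp add: a_def b_def)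
    also have "\<dots> = (\<Prod>i<d. if i < 2 then 1 / real (k ! i) else 1)"
      using assms(1) by (intro prod.mono_neutral_left) auto
    finally show "(\<Sum>t<T. walk_eigenvalue d n k ^ t)
        \<le> real d * N\<^sup>2 * (\<Prod>i<d. if i < 2 then 1 / real (k ! i) else 1)"
      by (simp add: \<rho>_def)
  qed
  have "(\<Sum>x\<in>grid_points d n. occupation d n v T x)
      = (\<Sum>x\<in>grid_points d n. \<Sum>t<T. \<Sum>k\<in>grid_points d n. (2 / N) ^ d
          * (grid_mode d n k v * grid_mode d n k x * walk_eigenvalue d n k ^ t))"
    unfolding occupation_def N_def
    by (intro sum.cong refl) (simp add: lazy_walk_spectral[OF d assms(2)] sum_distrib_left)
  also have "\<dots> = (\<Sum>k\<in>grid_points d n. \<Sum>x\<in>grid_points d n. \<Sum>t<T. (2 / N) ^ d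
          * (grid_mode d n k v * grid_mode d n k x * walk_eigenvalue d n k ^ t))"
    by (subst sum.swap[of _ "grid_points d n" "grid_points d n"]) (intro sum.cong refl sum.swap)
  also have "\<dots> = (2 / N) ^ d * (\<Sum>k\<in>grid_points d n. grid_mode d n k v
      * (\<Sum>x\<in>grid_points d n. grid_mode d n k x) * (\<Sum>t<T. walk_eigenvalue d n k ^ t))"
    by (simp only: sum_distrib_left[symmetric] sum_distrib_right[symmetric])
  also have "\<dots> \<le> (2 / N) ^ d * (\<Sum>k\<in>grid_points d n. (N ^ d * u)
      * (real d * N\<^sup>2 * (\<Prod>i<d. if i < 2 then 1 / real (k ! i) else 1)))"
  proof (intro mult_left_mono sum_mono)
    fix k assume k: "k \<in> grid_points d n"
    define P where "P = (\<Prod>i<d. real (k ! i))"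
    have P: "P > 0" unfolding P_def using grid_points_nth[OF k] by (intro prod_pos) force
    have "grid_mode d n k v * (\<Sum>x\<in>grid_points d n. grid_mode d n k x)
        \<le> \<bar>grid_mode d n k v\<bar> * \<bar>\<Sum>x\<in>grid_points d n. grid_mode d n k x\<bar>"
      by (simp flip: abs_mult)
    also have "\<dots> \<le> (P * u) * (N ^ d / P)"
      unfolding P_def u_def N_def
      by (intro mult_mono' abs_grid_mode_le[OF assms(2)] abs_sum_grid_mode_le[OF k]) auto
    also have "\<dots> = N ^ d * u" using P by simp
    finally have "grid_mode d n k v * (\<Sum>x\<in>grid_points d n. grid_mode d n k x) \<le> N ^ d * u" .
    then show "grid_mode d n k v * (\<Sum>x\<in>grid_points d n. grid_mode d n k x) * (\<Sum>t<T. walk_eigenvalue d n k ^ t)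
        \<le> N ^ d * u * (real d * N\<^sup>2 * (\<Prod>i<d. if i < 2 then 1 / real (k ! i) else 1))"
      by (rule order_trans[OF mult_right_mono mult_left_mono]) (use geo[OF k] geo_nonneg[OF k] u N in auto)
  qed (use N in simp)
  also have "\<dots> = (2 / N) ^ d * (N ^ d * u * (real d * N\<^sup>2
      * (\<Prod>i<d. \<Sum>j=1..n. if i < 2 then 1 / real j else 1)))"
    unfolding sum_distrib_left[symmetric]
      sum_grid_points_prod[of "\<lambda>i j. if i < 2 then 1 / real j else 1"] ..
  also have "(\<Prod>i<d. \<Sum>j=1..n. if i < 2 then 1 / real j else 1)
      = (\<Sum>j=1..n. 1 / real j)\<^sup>2 * real n ^ (d - 2)"
  proof -
    obtain e where e: "d = Suc (Suc e)" using assms(1) by (metis Suc_le_D numeral_2_eq_2 Suc_le_mono)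
    show ?thesis
      unfolding e by (simp add: prod.lessThan_Suc_shift power2_eq_square del: prod.lessThan_Suc)
  qed
  also have "(2 / N) ^ d * (N ^ d * u * (real d * N\<^sup>2 * ((\<Sum>j=1..n. 1 / real j)\<^sup>2 * real n ^ (d - 2))))
      = 2 ^ d * real d * N\<^sup>2 * (\<Sum>j=1..n. 1 / real j)\<^sup>2 * real n ^ (d - 2) * u"
  proof -
    have p: "(2 / N) ^ d * N ^ d = 2 ^ d" using N by (simp flip: power_mult_distrib)
    have "(2 / N) ^ d * (N ^ d * u * X) = 2 ^ d * (u * X)" for X
      unfolding p[symmetric] by (simp only: mult_ac)
    from this[of "real d * N\<^sup>2 * ((\<Sum>j=1..n. 1 / real j)\<^sup>2 * real n ^ (d - 2))"]
    show ?thesis by (elim trans) (simp only: mult_ac)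
  qed
  finally show ?thesis by (simp only: u_def N_def)
qed

section \<open>Dominance of the lowest mode\<close>

text \<open>The bound must tend to 1 for large \<open>L\<close>, since its \<open>d\<close>-th power
  has to stay below 3/2. The quadratic Taylor bound of the exponential already leaves inverse
  squares for \<open>j \<ge> 2\<close>.\<close>

lemma gaussian_sum_le:
  assumes "0 < L"
  shows "(\<Sum>j=1..n. (real j)\<^sup>2 * exp (- (L * ((real j)\<^sup>2 - 1)))) \<le> 1 + 8 / L\<^sup>2"
proof (cases n)
  case (Suc m)
  have summand: "(real j)\<^sup>2 * exp (- (L * ((real j)\<^sup>2 - 1))) \<le> 4 / L\<^sup>2 * (1 / (real j)\<^sup>2)" if j: "2 \<le> j" for j
  proof -
    define q where "q = (real j)\<^sup>2"
    have "2\<^sup>2 \<le> q" unfolding q_def using j by (intro power_mono) auto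
    then have q: "4 \<le> q" by simp
    have "1 / exp (L * (q - 1)) \<le> 1 / ((L * (q - 1))\<^sup>2 / 2)"
    proof (rule divide_left_mono)
      have "1 + L * (q - 1) + (L * (q - 1))\<^sup>2 / 2 \<le> exp (L * (q - 1))"
        using assms q by (intro exp_lower_Taylor_quadratic) simp
      moreover have "0 \<le> L * (q - 1)" using assms q by simp
      ultimately show "(L * (q - 1))\<^sup>2 / 2 \<le> exp (L * (q - 1))" by linarith
    qed (use assms q in auto)
    also have "\<dots> = 2 / (L\<^sup>2 * (q - 1)\<^sup>2)" by (simp add: power_mult_distrib)
    also have "\<dots> \<le> 2 / (L\<^sup>2 * (q\<^sup>2 / 2))"
    proof (intro divide_left_mono mult_left_mono)
      have "0 \<le> (q - 4) * q + 2" using q by (intro add_nonneg_nonneg mult_nonneg_nonneg) auto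
      then show "q\<^sup>2 / 2 \<le> (q - 1)\<^sup>2" by (simp add: power2_eq_square algebra_simps)
    qed (use assms q in auto)
    finally have "exp (- (L * (q - 1))) \<le> 4 / (L\<^sup>2 * q\<^sup>2)" by (simp add: exp_minus inverse_eq_divide)
    then have "q * exp (- (L * (q - 1))) \<le> q * (4 / (L\<^sup>2 * q\<^sup>2))" using q by (intro mult_left_mono) auto
    also have "\<dots> = 4 / L\<^sup>2 * (1 / q)" using q by (simp add: power2_eq_square)
    finally show ?thesis by (simp add: q_def)
  qed
  have "(\<Sum>j=1..n. (real j)\<^sup>2 * exp (- (L * ((real j)\<^sup>2 - 1))))
      = 1 + (\<Sum>j=2..n. (real j)\<^sup>2 * exp (- (L * ((real j)\<^sup>2 - 1))))"
    using Suc by (subst sum.atLeast_Suc_atMost) (auto simp: numeral_2_eq_2)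
  also have "\<dots> \<le> 1 + (\<Sum>j=2..n. 4 / L\<^sup>2 * (1 / (real j)\<^sup>2))"
    using summand by (intro add_left_mono sum_mono) auto
  also have "\<dots> \<le> 1 + 4 / L\<^sup>2 * (\<Sum>j=1..n. 1 / (real j)\<^sup>2)"
    unfolding sum_distrib_left[symmetric] by (intro add_left_mono mult_left_mono sum_mono2) auto
  also have "\<dots> \<le> 1 + 4 / L\<^sup>2 * 2"
    by (intro add_left_mono mult_left_mono sum_inverse_squares_le) auto
  finally show ?thesis by simp
qed simp

text \<open>A multiplicative comparison survives raising to the power \<open>t\<close>. If the two
  eigenvalues are 1 - a and 1 - b, then 1 - a <= (1 - b)(1 - (a - b)) because b(a - b) >= 0.\<close>

lemma walk_eigenvalue_le:
  assumes "0 < d" "k \<in> grid_points d n"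
  shows "walk_eigenvalue d n k \<le> walk_eigenvalue d n (replicate d 1)
    * exp (- ((\<Sum>i<d. (real (k ! i))\<^sup>2 - 1) / (real d * (real (Suc n))\<^sup>2)))"
proof -
  define N where "N = real (Suc n)"
  define a where "a = grid_freq d n k / real d"
  define b where "b = grid_freq d n (replicate d 1) / real d"
  define D where "D = (\<Sum>i<d. (real (k ! i))\<^sup>2 - 1) / (real d * N\<^sup>2)"
  have b1: "b \<le> 1" unfolding b_def using assms(1) grid_freq_le[of d n] by simp
  have "(\<Sum>i<d. ((real (k ! i))\<^sup>2 - 1) / N\<^sup>2) \<le> (\<Sum>i<d.
      (sin (pi * real (k ! i) / (2 * N)))\<^sup>2 - (sin (pi / (2 * N)))\<^sup>2)"
    unfolding N_def using grid_points_nth[OF assms(2)] by (intro sum_mono sin_sq_half_diff_ge) auto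
  also have "\<dots> = grid_freq d n k - grid_freq d n (replicate d 1)"
    by (simp add: grid_freq_def N_def sum_subtractf)
  finally have "(\<Sum>i<d. (real (k ! i))\<^sup>2 - 1) / N\<^sup>2 \<le> grid_freq d n k - grid_freq d n (replicate d 1)"
    by (simp only: sum_divide_distrib)
  then have "(\<Sum>i<d. (real (k ! i))\<^sup>2 - 1) / N\<^sup>2 / real d
      \<le> (grid_freq d n k - grid_freq d n (replicate d 1)) / real d"
    by (intro divide_right_mono) auto
  then have D: "D \<le> a - b" by (simp add: D_def a_def b_def diff_divide_distrib mult.commute)
  have D0: "0 \<le> D" unfolding D_def
    using grid_points_nth[OF assms(2)]
    by (intro divide_nonneg_nonneg sum_nonneg mult_nonneg_nonneg) (auto simp: one_le_power)
  have "0 \<le> b" by (simp add: b_def grid_freq_def sum_nonneg)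
  then have "0 \<le> b * (a - b)" using D D0 by (intro mult_nonneg_nonneg) auto
  then have "1 - a \<le> (1 - b) * (1 + - (a - b))" by (simp add: algebra_simps)
  also have "\<dots> \<le> (1 - b) * exp (- (a - b))"
    using b1 by (intro mult_left_mono exp_ge_add_one_self) auto
  also have "\<dots> \<le> (1 - b) * exp (- D)" using b1 D by (intro mult_left_mono) auto
  finally show ?thesis by (simp add: walk_eigenvalue_def a_def b_def D_def N_def)
qed

lemma exp_minus_double_le:
  assumes "0 \<le> x" "x \<le> 1 / 2"
  shows "exp (- (2 * x)) \<le> 1 - (x :: real)"
proof -
  have "1 \<le> (1 + 2 * x) * (1 - x)"
    using mult_nonneg_nonneg[of x "1 - 2 * x"] assms by (simp add: algebra_simps)
  also have "\<dots> \<le> exp (2 * x) * (1 - x)" using assms by (intro mult_right_mono exp_ge_add_one_self) auto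
  finally show ?thesis by (simp add: exp_minus field_simps)
qed

text \<open>By this time all other modes together amount to at most half of the lowest one. In the
  weights \<open>E k\<close> the Gaussian decay beats the squares of the \<open>k ! i\<close> that
  come from the two mode bounds.\<close>

lemma lazy_walk_ge:
  assumes "0 < d" "v \<in> grid_points d n" "x \<in> grid_points d n"
    and t: "8 * d\<^sup>2 * (Suc n)\<^sup>2 \<le> t"
  shows "(2 / real (Suc n)) ^ d * grid_mode d n (replicate d 1) v * grid_mode d n (replicate d 1) x
    * walk_eigenvalue d n (replicate d 1) ^ t / 2 \<le> lazy_walk d n v t x"
proof -
  define N where "N = real (Suc n)"
  define one where "one = replicate d (1 :: nat)"
  define \<rho> where "\<rho> = walk_eigenvalue d n"
  \<comment> \<open>The assumption on \<open>t\<close> makes \<open>t / (d * N\<^sup>2)\<close> at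
    least \<open>L\<close>, and \<open>8 / L\<^sup>2 = 1 / (8 * d\<^sup>2)\<close> keeps the
    \<open>d\<close>-th power of the one-dimensional sum close to 1.\<close>
  define L where "L = 8 * real d"
  define U where "U = grid_mode d n one v * grid_mode d n one x"
  define E where "E k = (\<Prod>i<d. (real (k ! i))\<^sup>2 * exp (- (L * ((real (k ! i))\<^sup>2 - 1))))" for k
  have N: "N > 0" by (simp add: N_def)
  have U: "U > 0" using grid_mode_one_pos assms(2,3) by (simp add: U_def one_def)
  have \<rho>0: "0 \<le> \<rho> k" for k
    using grid_freq_le[of d n k] assms(1) by (simp add: \<rho>_def walk_eigenvalue_def)
  have "n \<ge> 1" using grid_points_nth[OF assms(2), of 0] assms(1) by auto
  then have one: "one \<in> grid_points d n" by (auto simp: one_def grid_points_def)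
  have E_one: "E one = 1" by (simp add: E_def one_def)
  have pow: "\<rho> k ^ t \<le> \<rho> one ^ t * (\<Prod>i<d. exp (- (L * ((real (k ! i))\<^sup>2 - 1))))"
    if k: "k \<in> grid_points d n" for k
  proof -
    define S where "S = (\<Sum>i<d. (real (k ! i))\<^sup>2 - 1)"
    have S: "0 \<le> S" unfolding S_def using grid_points_nth[OF k]
      by (intro sum_nonneg) (auto simp: one_le_power)
    have "\<rho> k ^ t \<le> (\<rho> one * exp (- (S / (real d * N\<^sup>2)))) ^ t"
      using walk_eigenvalue_le[OF assms(1) k] \<rho>0
      by (intro power_mono) (auto simp: \<rho>_def S_def N_def one_def)
    also have "\<dots> = \<rho> one ^ t * exp (- (real t * (S / (real d * N\<^sup>2))))"
      by (simp add: power_mult_distrib exp_of_nat_mult[symmetric])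
    also have "\<dots> \<le> \<rho> one ^ t * exp (- (L * S))"
    proof (intro mult_left_mono)
      have "real (8 * d\<^sup>2 * (Suc n)\<^sup>2) \<le> real t" using t by (simp only: of_nat_le_iff)
      moreover have "real (8 * d\<^sup>2 * (Suc n)\<^sup>2) = L * (real d * N\<^sup>2)"
        unfolding L_def N_def of_nat_mult of_nat_power by (simp add: power2_eq_square)
      ultimately have "L * (real d * N\<^sup>2) \<le> real t" by simp
      then have "L \<le> real t / (real d * N\<^sup>2)" using assms(1) N by (simp add: pos_le_divide_eq)
      then have "L * S \<le> real t / (real d * N\<^sup>2) * S" using S by (intro mult_right_mono)
      then show "exp (- (real t * (S / (real d * N\<^sup>2)))) \<le> exp (- (L * S))" by simp
    qed (simp add: \<rho>0)
    also have "exp (- (L * S)) = (\<Prod>i<d. exp (- (L * ((real (k ! i))\<^sup>2 - 1))))"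
      by (simp add: S_def sum_distrib_left sum_negf[symmetric] exp_sum)
    finally show ?thesis .
  qed
  have summand: "\<bar>grid_mode d n k v * grid_mode d n k x * \<rho> k ^ t\<bar> \<le> U * \<rho> one ^ t * E k"
    if k: "k \<in> grid_points d n" for k
  proof -
    define P where "P = (\<Prod>i<d. real (k ! i))"
    have "\<bar>grid_mode d n k v * grid_mode d n k x * \<rho> k ^ t\<bar>
        = \<bar>grid_mode d n k v\<bar> * \<bar>grid_mode d n k x\<bar> * \<rho> k ^ t"
      by (simp add: abs_mult \<rho>0)
    also have "\<dots> \<le> (P * grid_mode d n one v) * (P * grid_mode d n one x)
        * (\<rho> one ^ t * (\<Prod>i<d. exp (- (L * ((real (k ! i))\<^sup>2 - 1)))))"
      unfolding P_def one_def using pow[OF k, unfolded one_def] \<rho>0[of k]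
      by (intro mult_mono' abs_grid_mode_le assms(2,3)) auto
    also have "\<dots> = U * \<rho> one ^ t * E k"
      by (simp add: U_def E_def P_def prod.distrib power2_eq_square mult_ac)
    finally show ?thesis .
  qed
  have sum_E: "(\<Sum>k\<in>grid_points d n. E k) \<le> 3 / 2"
  proof -
    have "(\<Sum>k\<in>grid_points d n. E k) = (\<Sum>j=1..n. (real j)\<^sup>2 * exp (- (L * ((real j)\<^sup>2 - 1)))) ^ d"
      unfolding E_def
        sum_grid_points_prod[of "\<lambda>i j. (real j)\<^sup>2 * exp (- (L * ((real j)\<^sup>2 - 1)))"]
      by simp
    also have "\<dots> \<le> (1 + 8 / L\<^sup>2) ^ d"
      using assms(1) by (intro power_mono gaussian_sum_le sum_nonneg) (auto simp: L_def)
    also have "\<dots> \<le> exp (8 / L\<^sup>2) ^ d"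
      by (intro power_mono exp_ge_add_one_self) auto
    also have "\<dots> = exp (1 / (8 * real d))"
      using assms(1) by (simp add: L_def power2_eq_square field_simps flip: exp_of_nat_mult)
    also have "\<dots> \<le> exp (1 / 8)"
      using assms(1) by simp
    also have "\<dots> \<le> 1 + 1 / 8 + (1 / 8)\<^sup>2" by (intro exp_bound) auto
    also have "\<dots> \<le> 3 / 2" by (simp add: power2_eq_square)
    finally show ?thesis .
  qed
  have "(\<Sum>k\<in>grid_points d n - {one}. E k) \<le> 1 / 2"
    using sum_E one E_one finite_grid_points by (simp add: sum_diff1)
  then have rest: "U * \<rho> one ^ t * (\<Sum>k\<in>grid_points d n - {one}. E k) \<le> U * \<rho> one ^ t * (1 / 2)"
    using U \<rho>0 by (intro mult_left_mono) auto
  have "\<bar>\<Sum>k\<in>grid_points d n - {one}. grid_mode d n k v * grid_mode d n k x * \<rho> k ^ t\<bar>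
      \<le> (\<Sum>k\<in>grid_points d n - {one}. U * \<rho> one ^ t * E k)"
    by (rule order_trans[OF sum_abs]) (intro sum_mono summand, simp)
  also have "\<dots> \<le> U * \<rho> one ^ t / 2" using rest by (simp flip: sum_distrib_left)
  finally have "U * \<rho> one ^ t / 2
      \<le> U * \<rho> one ^ t + (\<Sum>k\<in>grid_points d n - {one}. grid_mode d n k v * grid_mode d n k x * \<rho> k ^ t)"
    by linarith
  also have "\<dots> = (\<Sum>k\<in>grid_points d n. grid_mode d n k v * grid_mode d n k x * \<rho> k ^ t)"
    using one finite_grid_points by (simp add: sum.remove U_def)
  finally have "(2 / N) ^ d * (U * \<rho> one ^ t / 2)
      \<le> (2 / N) ^ d * (\<Sum>k\<in>grid_points d n. grid_mode d n k v * grid_mode d n k x * \<rho> k ^ t)"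
    using N by (intro mult_left_mono) auto
  then show ?thesis
    unfolding lazy_walk_spectral[OF assms(1-3)] by (simp add: U_def \<rho>_def N_def one_def mult.assoc)
qed

lemma grid_mode_one_ge:
  assumes "x \<in> grid_points d n"
  shows "(2 / real (Suc n)) ^ d \<le> grid_mode d n (replicate d 1) x"
proof -
  have "(\<Prod>i<d. 2 / real (Suc n)) \<le> (\<Prod>i<d. sine_mode n 1 (x ! i))"
    using grid_points_nth[OF assms] by (intro prod_mono conjI sine_mode_ge) auto
  then show ?thesis by (simp only: grid_mode_one prod_constant card_lessThan)
qed

text \<open>Only times in \<open>{T..<2 * T}\<close> are counted: late enough for the lowest mode to
  dominate, early enough for it not to have decayed. There
  \<open>t \<le> 16 * d\<^sup>2 * N\<^sup>2\<close>, and the top eigenvalue is at least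
  \<open>exp (- (8 / N\<^sup>2))\<close>, whence 128.\<close>

lemma occupation_ge:
  assumes "0 < d" "2 \<le> n" "v \<in> grid_points d n" "x \<in> grid_points d n"
    and T: "T = 8 * d\<^sup>2 * (Suc n)\<^sup>2"
  shows "4 * (real d)\<^sup>2 * (real (Suc n))\<^sup>2 * (4 / (real (Suc n))\<^sup>2) ^ d * exp (- (128 * (real d)\<^sup>2))
    * grid_mode d n (replicate d 1) v \<le> occupation d n v (2 * T) x"
proof -
  define N where "N = real (Suc n)"
  define one where "one = replicate d (1 :: nat)"
  define \<rho> where "\<rho> = walk_eigenvalue d n one"
  define u where "u = grid_mode d n one"
  have N: "N \<ge> 3" using assms(2) by (simp add: N_def of_nat_Suc)
  have u: "u v > 0" "(2 / N) ^ d \<le> u x"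
    using grid_mode_one_pos[OF assms(3)] grid_mode_one_ge[OF assms(4)] by (auto simp: u_def N_def one_def)
  have \<rho>: "exp (- (8 / N\<^sup>2)) \<le> \<rho>" "\<rho> \<le> 1"
  proof -
    define s where "s = (sin (pi / (2 * N)))\<^sup>2"
    have \<rho>s: "\<rho> = 1 - s"
      using assms(1) by (simp add: \<rho>_def walk_eigenvalue_def grid_freq_def one_def s_def N_def)
    have "sin (pi / (2 * N)) \<le> pi / (2 * N)" using N by (intro sin_x_le_x) simp
    also have "\<dots> \<le> 4 / (2 * N)" using pi_less_4 N by (intro divide_right_mono) auto
    finally have "sin (pi / (2 * N)) \<le> 2 / N" by simp
    moreover have "0 \<le> sin (pi / (2 * N))" using N by (intro sin_ge_zero) (auto simp: field_simps)
    ultimately have "s \<le> (2 / N)\<^sup>2" unfolding s_def by (intro power_mono)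
    then have s: "s \<le> 4 / N\<^sup>2" by (simp add: power_divide)
    \<comment> \<open>\<open>n \<ge> 2\<close> enters here: it brings \<open>s\<close> below 1/2,
      the range of \<open>exp_minus_double_le\<close>.\<close>
    have "3\<^sup>2 \<le> N\<^sup>2" using N by (intro power_mono) auto
    then have "4 / N\<^sup>2 \<le> 4 / 8" by (intro divide_left_mono) auto
    then have "exp (- (2 * s)) \<le> 1 - s" using s by (intro exp_minus_double_le) (auto simp: s_def)
    moreover have "exp (- (8 / N\<^sup>2)) \<le> exp (- (2 * s))" using s by simp
    ultimately show "exp (- (8 / N\<^sup>2)) \<le> \<rho>"
      unfolding \<rho>s by (rule order_trans[rotated])
    show "\<rho> \<le> 1" by (simp add: \<rho>s s_def)
  qed
  have walk: "(2 / N) ^ d * u v * (2 / N) ^ d * exp (- (128 * (real d)\<^sup>2)) / 2 \<le> lazy_walk d n v t x"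
    if t: "t \<in> {T..<2 * T}" for t
  proof -
    have "real t \<le> real (2 * (8 * d\<^sup>2 * (Suc n)\<^sup>2))" using t unfolding T by (simp only: of_nat_le_iff) simp
    then have rt: "real t \<le> 16 * (real d)\<^sup>2 * N\<^sup>2" by (simp add: N_def)
    have "exp (- (128 * (real d)\<^sup>2)) \<le> exp (- (real t * (8 / N\<^sup>2)))"
      using rt N by (simp add: field_simps)
    also have "\<dots> = exp (- (8 / N\<^sup>2)) ^ t" by (simp flip: exp_of_nat_mult)
    also have "\<dots> \<le> \<rho> ^ t" using \<rho>(1) by (intro power_mono) auto
    finally have e: "exp (- (128 * (real d)\<^sup>2)) \<le> \<rho> ^ t" .
    have "(2 / N) ^ d * u v * (2 / N) ^ d * exp (- (128 * (real d)\<^sup>2)) / 2 \<le> (2 / N) ^ d * u v * u x * \<rho> ^ t / 2"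
    proof (intro divide_right_mono)
      have "0 \<le> u x" using u(2) N by (meson divide_nonneg_pos less_le_trans order_trans zero_le_numeral zero_le_power zero_less_numeral)
      then show "(2 / N) ^ d * u v * (2 / N) ^ d * exp (- (128 * (real d)\<^sup>2)) \<le> (2 / N) ^ d * u v * u x * \<rho> ^ t"
        using u N e by (intro mult_mono mult_nonneg_nonneg) auto
    qed simp
    also have "\<dots> \<le> lazy_walk d n v t x"
      unfolding N_def u_def \<rho>_def one_def
      using t by (intro lazy_walk_ge assms(1,3,4)) (simp add: T)
    finally show ?thesis .
  qed
  have "real T * ((2 / N) ^ d * u v * (2 / N) ^ d * exp (- (128 * (real d)\<^sup>2)) / 2)
      = (\<Sum>t\<in>{T..<2 * T}. (2 / N) ^ d * u v * (2 / N) ^ d * exp (- (128 * (real d)\<^sup>2)) / 2)"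
    by simp
  also have "\<dots> \<le> (\<Sum>t\<in>{T..<2 * T}. lazy_walk d n v t x)" by (intro sum_mono walk)
  also have "\<dots> \<le> occupation d n v (2 * T) x"
    unfolding occupation_def by (intro sum_mono2) (auto simp: lazy_walk_nonneg)
  also have "real T * ((2 / N) ^ d * u v * (2 / N) ^ d * exp (- (128 * (real d)\<^sup>2)) / 2)
      = 4 * (real d)\<^sup>2 * N\<^sup>2 * (4 / N\<^sup>2) ^ d * exp (- (128 * (real d)\<^sup>2)) * u v"
  proof -
    have "(4 / N\<^sup>2) ^ d = (2 / N) ^ d * (2 / N) ^ d"
      by (simp add: power2_eq_square flip: power_mult_distrib)
    moreover have "real T = 8 * (real d)\<^sup>2 * N\<^sup>2" by (simp add: T N_def)
    ultimately show ?thesis by simp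
  qed
  finally show ?thesis by (simp only: N_def u_def one_def)
qed

section \<open>Bounds for the transience class\<close>

lemma dissipative_grid:
  assumes "0 < d"
  shows "dissipative_sink_graph (grid d n)
    (\<lambda>v. case v of None \<Rightarrow> 0 | Some x \<Rightarrow> grid_mode d n (replicate d 1) x)"
proof -
  interpret finite_sink_graph "grid d n" by (rule finite_sink_graph_grid)
  show ?thesis
  proof
    fix v assume "v \<in> nonsink (grid d n)"
    then obtain x where x: "v = Some x" "x \<in> grid_points d n" by (auto simp: nonsink_grid)
    have u: "grid_mode d n (replicate d 1) x > 0" by (rule grid_mode_one_pos[OF x(2)])
    then show "0 < (case v of None \<Rightarrow> 0 | Some x \<Rightarrow> grid_mode d n (replicate d 1) x)"
      by (simp add: x(1))
    have "0 < 4 * grid_freq d n (replicate d 1) * grid_mode d n (replicate d 1) x"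
      using u grid_freq_one_pos[OF assms] by simp
    then show "0 < laplacian (grid d n)
        (\<lambda>v. case v of None \<Rightarrow> 0 | Some x \<Rightarrow> grid_mode d n (replicate d 1) x) v"
      unfolding x(1) laplacian_grid[OF x(2)] option.case sum_nbrs_grid_mode[OF x(2)]
      by (simp only: left_diff_distrib)
  qed
qed

lemma grid_potential:
  assumes d: "2 \<le> d" and n: "2 \<le> n" and v: "v \<in> nonsink (grid d n)"
  shows "\<exists>h m. m > 0 \<and> (\<forall>x\<in>nonsink (grid d n). m \<le> h x)
      \<and> (\<forall>x\<in>nonsink (grid d n). x \<noteq> v \<longrightarrow> laplacian (grid d n) h x \<le> 0)
      \<and> (\<Sum>x\<in>nonsink (grid d n). real (deg (grid d n) x) * h x)
        \<le> exp (128 * (real d)\<^sup>2) * (\<Sum>j=1..n. 1 / real j)\<^sup>2 * real (Suc n) ^ (3 * d - 2) * m"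
proof -
  obtain v' where v': "v = Some v'" "v' \<in> grid_points d n" using v by (auto simp: nonsink_grid)
  define T where "T = 2 * (8 * d\<^sup>2 * (Suc n)\<^sup>2)"
  define h where "h w = (case w of None \<Rightarrow> 0 | Some x \<Rightarrow> occupation d n v' T x)" for w
  define N where "N = real (Suc n)"
  define u where "u = grid_mode d n (replicate d 1) v'"
  define K where "K = exp (128 * (real d)\<^sup>2)"
  define A where "A = (\<Sum>j=1..n. 1 / real j)\<^sup>2"
  define m where "m = 4 * (real d)\<^sup>2 * N\<^sup>2 * (4 / N\<^sup>2) ^ d * exp (- (128 * (real d)\<^sup>2)) * u"
  have d0: "0 < d" using d by simp
  have pos: "N > 0" "u > 0" "K > 0" "A \<ge> 0"
    using grid_mode_one_pos[OF v'(2)] by (auto simp: N_def u_def K_def A_def)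
  have "m > 0" using pos d0 by (simp add: m_def)
  moreover have "m \<le> h x" if "x \<in> nonsink (grid d n)" for x
    using that occupation_ge[OF d0 n v'(2) _ refl]
    by (auto simp: nonsink_grid h_def m_def N_def u_def T_def)
  moreover have "laplacian (grid d n) h x \<le> 0" if x: "x \<in> nonsink (grid d n)" "x \<noteq> v" for x
  proof -
    obtain x' where x': "x = Some x'" "x' \<in> grid_points d n" "x' \<noteq> v'"
      using x v' by (auto simp: nonsink_grid)
    have "laplacian (grid d n) h x = - (4 * real d * lazy_walk d n v' T x')"
      unfolding x'(1) laplacian_grid[OF x'(2)] h_def option.case occupation_nbrs[OF d0]
      using x'(3) by simp
    then show ?thesis by (simp add: lazy_walk_nonneg)
  qed
  moreover have "(\<Sum>x\<in>nonsink (grid d n). real (deg (grid d n) x) * h x) \<le> K * A * N ^ (3 * d - 2) * m"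
  proof -
    obtain e where e: "d = e + 2" using d by (metis add.commute le_Suc_ex)
    have "(\<Sum>x\<in>nonsink (grid d n). real (deg (grid d n) x) * h x)
        = 2 * real d * (\<Sum>x\<in>grid_points d n. occupation d n v' T x)"
      by (simp add: nonsink_grid sum.reindex h_def deg_grid sum_distrib_left)
    also have "\<dots> \<le> 2 * real d * (2 ^ d * real d * N\<^sup>2 * A * real n ^ e * u)"
      using sum_occupation_le[OF d v'(2), of T] by (intro mult_left_mono) (auto simp: N_def A_def u_def e)
    \<comment> \<open>Rounding up here makes the constants match those of \<open>m\<close>, so that
      the quotient is exactly \<open>K * A * N ^ (3 * d - 2)\<close>.\<close>
    also have "\<dots> \<le> 2 * real d * (4 ^ d * real d * N\<^sup>2 * A * N ^ e * (2 * u))"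
      using pos by (intro mult_left_mono mult_mono power_mono mult_nonneg_nonneg) (auto simp: N_def)
    also have "\<dots> = 4 * (real d)\<^sup>2 * 4 ^ d * A * N ^ d * u"
      by (simp add: e power_add power2_eq_square mult_ac)
    also have "\<dots> = K * A * N ^ (3 * d - 2) * m"
    proof -
      have "3 * d - 2 + 2 = d + 2 * d" using d by simp
      then have N3: "N ^ (3 * d - 2) * N\<^sup>2 = N ^ d * (N\<^sup>2) ^ d"
        by (simp only: power_mult[symmetric] power_add[symmetric])
      have K: "K * exp (- (128 * (real d)\<^sup>2)) = 1" by (simp add: K_def flip: exp_add)
      have "K * A * N ^ (3 * d - 2) * m
          = (K * exp (- (128 * (real d)\<^sup>2))) * (N ^ (3 * d - 2) * N\<^sup>2) * (4 / N\<^sup>2) ^ d * (4 * (real d)\<^sup>2 * A * u)"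
        unfolding m_def by (simp only: mult_ac)
      also have "\<dots> = 4 * (real d)\<^sup>2 * 4 ^ d * A * N ^ d * u"
        unfolding K N3 using pos(1) by (simp add: power_divide)
      finally show ?thesis by (rule sym)
    qed
    finally show ?thesis .
  qed
  ultimately show ?thesis unfolding K_def A_def N_def by blast
qed

lemma tcl_grid_le:
  assumes d: "2 \<le> d" and n: "2 \<le> n"
  shows "real (tcl (grid d n))
    \<le> exp (128 * (real d)\<^sup>2) * (\<Sum>j=1..n. 1 / real j)\<^sup>2 * real (Suc n) ^ (3 * d - 2)" (is "_ \<le> ?B")
proof -
  have d0: "0 < d" using d by simp
  interpret dissipative_sink_graph "grid d n"
      "\<lambda>v. case v of None \<Rightarrow> 0 | Some x \<Rightarrow> grid_mode d n (replicate d 1) x"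
    by (rule dissipative_grid[OF d0])
  have "replicate d 1 \<in> grid_points d n" using n by (intro replicate_in_grid_points) auto
  then have "nonsink (grid d n) \<noteq> {}" by (auto simp: nonsink_grid)
  then have le: "real k \<le> ?B" if "k \<in> transient_lengths (grid d n)" for k
    using transient_length_le[OF that _ grid_potential[OF d n]] by blast
  show ?thesis
  proof (cases "transient_lengths (grid d n) = {}")
    case True
    then show ?thesis by (simp add: tcl_def Sup_nat_empty)
  next
    case False
    then have "tcl (grid d n) \<in> transient_lengths (grid d n)"
      unfolding tcl_def Sup_nat_def using finite_transient_lengths[OF finite_verts] by simp
    then show ?thesis by (rule le)
  qed
qed

text \<open>The source forces \<open>1 \<le> 2 * d * h v\<close> at the corner \<open>v\<close>, and
  harmonicity at the neighbour \<open>w\<close> loses a further factor \<open>2 * d\<close>; hence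
  the threshold \<open>1 / (4 * d\<^sup>2)\<close>, where \<open>d = Suc e\<close>.\<close>

lemma tcl_grid_ge:
  assumes "1 \<le> e" "2 \<le> n" "2 * e \<le> n"
    and k: "real k * ((4 * pi\<^sup>2) ^ e * real (4 * e + 1) ^ (4 * e + 1) / real n ^ (3 * e + 1))
      < 1 / (4 * (real (Suc e))\<^sup>2)"
  shows "k \<le> tcl (grid (Suc e) n)"
proof -
  define d where "d = Suc e"
  have d: "2 \<le> d" "0 < d" using assms(1) by (auto simp: d_def)
  interpret dissipative_sink_graph "grid d n"
      "\<lambda>v. case v of None \<Rightarrow> 0 | Some x \<Rightarrow> grid_mode d n (replicate d 1) x"
    by (rule dissipative_grid[OF d(2)])
  define h where "h w = (case w of None \<Rightarrow> 0 | Some x \<Rightarrow> corner_measure e n x)" for w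
  define v where "v = replicate d (1 :: nat)"
  define w where "w = 2 # replicate e (1 :: nat)"
  define y where "y = replicate d n"
  have mem: "v \<in> grid_points d n" "w \<in> grid_points d n" "y \<in> grid_points d n"
    using assms(2) by (auto simp: v_def w_def y_def d_def grid_points_def)
  have super: "(\<Sum>y\<in>grid_nbrs d n x. corner_measure e n y)
      = 2 * real d * corner_measure e n x - (if x = v then 1 else 0)" if "x \<in> grid_points d n" for x
    using corner_measure_nbrs[of x e n] that by (simp add: d_def v_def)
  \<comment> \<open>The sum defining the corner measure has terms of both signs; its sign comes from
    the minimum principle.\<close>
  have nonneg: "0 \<le> corner_measure e n x" if "x \<in> grid_points d n" for x
    by (rule grid_superharmonic_nonneg[OF d(2) _ that]) (simp add: super)
  have nbrs_nonneg: "0 \<le> (\<Sum>y\<in>grid_nbrs d n x. corner_measure e n y)" for x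
    by (intro sum_nonneg nonneg) (auto simp: grid_nbrs_def)
  have adj: "grid_adj d v w" "grid_adj d w v" and vw: "v \<noteq> w"
    by (auto simp: grid_adj_def v_def w_def d_def intro!: exI[of _ 0])
  have "1 \<le> 2 * real d * corner_measure e n v"
    using super[OF mem(1)] nbrs_nonneg[of v] by simp
  then have hv: "1 / (2 * real d) \<le> corner_measure e n v"
    using d(2) by (simp add: pos_divide_le_eq mult.commute)
  have "corner_measure e n v \<le> (\<Sum>y\<in>grid_nbrs d n w. corner_measure e n y)"
    using adj(2) mem(1) nonneg
    by (intro member_le_sum) (auto simp: grid_nbrs_def finite_grid_points)
  also have "\<dots> = 2 * real d * corner_measure e n w" using super[OF mem(2)] vw by simp
  finally have "1 / (2 * real d) \<le> 2 * real d * corner_measure e n w" using hv by linarith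
  then have hw: "1 / (4 * (real d)\<^sup>2) \<le> corner_measure e n w"
    using d(2) by (simp add: pos_divide_le_eq power2_eq_square mult_ac)
  have "1 / (4 * (real d)\<^sup>2) \<le> 1 / (2 * real d)"
  proof (intro divide_left_mono mult_pos_pos)
    have "real d * 2 \<le> real d * (4 * real d)" using d by (intro mult_left_mono) auto
    then show "2 * real d \<le> 4 * (real d)\<^sup>2" by (simp add: power2_eq_square mult_ac)
  qed (use d in auto)
  then have hv': "1 / (4 * (real d)\<^sup>2) \<le> corner_measure e n v" using hv by linarith
  have "real k * corner_measure e n y \<le> real k
      * ((4 * pi\<^sup>2) ^ e * real (4 * e + 1) ^ (4 * e + 1) / real n ^ (3 * e + 1))"
    using corner_measure_far_le[of e n] assms(2,3) unfolding y_def d_def by (intro mult_left_mono) auto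
  also have "\<dots> < 1 / (4 * (real d)\<^sup>2)" using k by (simp add: d_def)
  finally have small: "real k * corner_measure e n y < 1 / (4 * (real d)\<^sup>2)" .
  have "k \<in> transient_lengths (grid d n)"
  proof (rule transient_lengthI[of "Some y" "Some v" "Some w" h])
    show "mult (grid d n) (Some v) (Some w) > 0" using adj(1) by (simp add: grid_def)
    show "\<exists>h m. m > 0 \<and> (\<forall>x\<in>nonsink (grid d n). m \<le> h x)
      \<and> (\<forall>x\<in>nonsink (grid d n). x \<noteq> z \<longrightarrow> laplacian (grid d n) h x \<le> 0)"
      if "z \<in> nonsink (grid d n)" for z
      using grid_potential[OF d(1) assms(2) that] by blast
    fix x assume "x \<in> nonsink (grid d n)"
    then obtain x' where x': "x = Some x'" "x' \<in> grid_points d n" by (auto simp: nonsink_grid)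
    show "0 \<le> h x" using nonneg[OF x'(2)] by (simp add: h_def x'(1))
    show "0 \<le> laplacian (grid d n) h x"
      unfolding x'(1) laplacian_grid[OF x'(2)] h_def option.case super[OF x'(2)] by simp
  qed (use mem vw small hv' hw in \<open>auto simp: nonsink_grid h_def\<close>)
  then show ?thesis
    unfolding tcl_def d_def[symmetric] Sup_nat_def
    using finite_transient_lengths[OF finite_verts] by (auto intro: Max_ge)
qed

section \<open>Asymptotics in n\<close>

lemma harmonic_sum_le:
  assumes "1 \<le> n"
  shows "(\<Sum>j=1..n. 1 / real j) \<le> 1 + ln (real n)"
  using assms
proof (induction n rule: dec_induct)
  case (step n)
  have n: "0 < real n" using step by simp
  have "ln (real n / real (Suc n)) \<le> real n / real (Suc n) - 1"
    using n by (intro ln_le_minus_one) simp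
  also have "\<dots> = - (1 / real (Suc n))" by (simp add: field_simps of_nat_Suc)
  finally have "ln (real n) - ln (real (Suc n)) \<le> - (1 / real (Suc n))"
    using n by (simp add: ln_div)
  then show ?case using step by simp
qed simp

theorem mainTheorem3:
  fixes d :: nat
  assumes "d \<ge> 2"
  shows "(\<lambda>n. real (tcl (grid d n))) \<in> O(\<lambda>n. real n ^ (3 * d - 2) * ln (real n) ^ (d + 2))
       \<and> (\<lambda>n. real (tcl (grid d n))) \<in> \<Omega>(\<lambda>n. real n ^ (3 * d - 2))"
proof
  have "real (tcl (grid d n)) \<le> exp (128 * (real d)\<^sup>2) * 4 * 2 ^ (3 * d - 2)
      * (real n ^ (3 * d - 2) * ln (real n) ^ (d + 2))" and "0 \<le> ln (real n)" if n: "3 \<le> n" for n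
  proof -
    have "exp 1 \<le> real n" using exp_le n by linarith
    then have ln: "1 \<le> ln (real n)" using n by (simp add: ln_ge_iff)
    then show "0 \<le> ln (real n)" by simp
    have "(\<Sum>j=1..n. 1 / real j) \<le> 2 * ln (real n)"
      using harmonic_sum_le[of n] n ln by linarith
    then have "(\<Sum>j=1..n. 1 / real j)\<^sup>2 \<le> (2 * ln (real n))\<^sup>2"
      by (intro power_mono sum_nonneg) auto
    also have "\<dots> = 4 * ln (real n) ^ 2" by (simp add: power_mult_distrib)
    \<comment> \<open>The argument yields the square of the logarithm;
      \<open>ln (real n) \<ge> 1\<close> raises the exponent to the stated one.\<close>
    also have "\<dots> \<le> 4 * ln (real n) ^ (d + 2)"
      using ln by (intro mult_left_mono power_increasing) auto
    finally have H: "(\<Sum>j=1..n. 1 / real j)\<^sup>2 \<le> 4 * ln (real n) ^ (d + 2)" .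
    have "real (Suc n) ^ (3 * d - 2) \<le> (2 * real n) ^ (3 * d - 2)"
      using n by (intro power_mono) (auto simp: of_nat_Suc)
    then have N: "real (Suc n) ^ (3 * d - 2) \<le> 2 ^ (3 * d - 2) * real n ^ (3 * d - 2)"
      by (simp add: power_mult_distrib)
    have "real (tcl (grid d n)) \<le> exp (128 * (real d)\<^sup>2) * (\<Sum>j=1..n. 1 / real j)\<^sup>2 * real (Suc n) ^ (3 * d - 2)"
      using n by (intro tcl_grid_le assms) auto
    also have "\<dots> \<le> exp (128 * (real d)\<^sup>2) * (4 * ln (real n) ^ (d + 2))
        * (2 ^ (3 * d - 2) * real n ^ (3 * d - 2))"
      using H N ln by (intro mult_mono mult_left_mono mult_nonneg_nonneg zero_le_power) auto
    finally show "real (tcl (grid d n)) \<le> exp (128 * (real d)\<^sup>2) * 4 * 2 ^ (3 * d - 2)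
      * (real n ^ (3 * d - 2) * ln (real n) ^ (d + 2))" by (simp only: mult_ac)
  qed
  then show "(\<lambda>n. real (tcl (grid d n))) \<in> O(\<lambda>n. real n ^ (3 * d - 2) * ln (real n) ^ (d + 2))"
    by (intro bigoI[where c = "exp (128 * (real d)\<^sup>2) * 4 * 2 ^ (3 * d - 2)"]
        eventually_sequentiallyI[of 3]) (simp add: abs_mult)
next
  obtain e where e: "d = Suc e" "1 \<le> e" using assms by (metis Suc_le_D Suc_le_mono numeral_2_eq_2 One_nat_def)
  define C where "C = (4 * pi\<^sup>2) ^ e * real (4 * e + 1) ^ (4 * e + 1)"
  \<comment> \<open>With the integer part \<open>k\<close> of \<open>q / D\<close>, the quantity
    \<open>k * C / q\<close> is at most half of the threshold \<open>1 / (4 * d\<^sup>2)\<close>,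
    which gives the strict inequality.\<close>
  define D where "D = 8 * (real d)\<^sup>2 * C"
  have C: "C > 0" by (simp add: C_def)
  then have D: "D > 0" using assms by (simp add: D_def)
  have p: "3 * d - 2 = 3 * e + 1" by (simp add: e(1))
  have "1 / (2 * D) * real n ^ (3 * d - 2) \<le> real (tcl (grid d n))"
    if n: "nat \<lceil>2 * D\<rceil> + 2 * e + 2 \<le> n" for n
  proof -
    have n2: "2 \<le> n" "2 * e \<le> n" "2 * D \<le> real n" using n by linarith+
    define q where "q = real n ^ (3 * e + 1)"
    have "real n ^ 1 \<le> q" unfolding q_def using n2 by (intro power_increasing) auto
    then have q: "2 * D \<le> q" "q > 0" using n2 D by auto
    define k where "k = nat \<lfloor>q / D\<rfloor>"
    have k: "real k \<le> q / D" "q / D - 1 \<le> real k"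
      using q D by (auto simp: k_def floor_le_iff of_nat_nat)
    have "real k * (C / q) \<le> q / D * (C / q)" using k(1) q C by (intro mult_right_mono) auto
    also have "\<dots> = 1 / (8 * (real d)\<^sup>2)" using q C by (simp add: D_def)
    also have "\<dots> < 1 / (4 * (real d)\<^sup>2)" using assms by (intro divide_strict_left_mono) auto
    finally have "k \<le> tcl (grid (Suc e) n)"
      using n2 e by (intro tcl_grid_ge) (auto simp: C_def q_def)
    then have "q / D - 1 \<le> real (tcl (grid d n))" using k(2) by (simp add: e(1))
    \<comment> \<open>Rounding down costs at most 1, and this is at most half of
      \<open>q / D\<close>.\<close>
    moreover have "1 \<le> q / (2 * D)" using q D by (simp add: pos_le_divide_eq)
    moreover have "q / D = 2 * (q / (2 * D))" "1 / (2 * D) * q = q / (2 * D)" by simp_all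
    ultimately show ?thesis unfolding p q_def[symmetric] by linarith
  qed
  then show "(\<lambda>n. real (tcl (grid d n))) \<in> \<Omega>(\<lambda>n. real n ^ (3 * d - 2))"
    by (intro landau_omega.bigI[of "1 / (2 * D)"]
        eventually_sequentiallyI[of "nat \<lceil>2 * D\<rceil> + 2 * e + 2"]) (use D in auto)
qed

end
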